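(* Let $f=\sum_{k\ge 2}f_k$ be the function constructed in the context, and let $\sigma^2:=2(\ln 2)^2$. Then $$\sup_{x\in\mathbb{Z}}\left|\sqrt{n}\,\mu\left(S_n(f)=x\right)-\frac{e^{-x^2/(2n\sigma^2)}}{\sqrt{2\pi\sigma^2}}\right|\xrightarrow[n\to\infty]{}0 .$$
   Context: $\log$ is the logarithm to base $2$ and $\ln$ is the natural logarithm. $(X,\mathcal{B},\mu,T)$ is an ergodic invertible probability measure preserving transformation, $Ug=g\circ T$ is its Koopman operator on $L^2(X,\mu)$, and $S_n(g)=\sum_{j=0}^{n-1}g\circ T^j$. For integers $k\ge 2$ put $p_k=2^k$ if $k$ is even, $p_k=2^{k-1}+1$ if $k$ is odd, $d_k=2^{k^2}$, and $\alpha_k=\frac{1}{p_k\sqrt{k\log k}}$. Let $\bar f_k:X\to\{-1,0,1\}$, $k\ge 2$, be measurable functions such that: (a) for every $k$, $\{\bar f_k\circ T^j\}_{j=0}^{2d_k+p_k}$ is an i.i.d. sequence with $\mu(\bar f_k=1)=\mu(\bar f_k=-1)=\alpha_k^2/2$; (b) for every $k$, the finite sequence $\{\bar f_k\circ T^j\}_{j=0}^{2d_k+p_k}$ is independent of the family $\{\bar f_l\circ T^j:\ 2\le l<k,\ 0\le j\le 2d_k+p_k\}$. Define $f_k=\sum_{i=0}^{p_k-1}U^i\bar f_k-U^{d_k}\Big(\sum_{i=0}^{p_k-1}U^i\bar f_k\Big)$ and $f=\sum_{k\ge 2}f_k$ (a series converging in $L^2(X,\mu)$). *)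

theory Defs
  imports "HOL-Probability.Probability"
begin

locale ergodic_invertible_pmpt = prob_space M for M :: "'a measure" +
  fixes T :: "'a \<Rightarrow> 'a"
  assumes bij: "bij_betw T (space M) (space M)"
    and measurable_T: "T \<in> measurable M M"
    and measurable_inv: "the_inv_into (space M) T \<in> measurable M M"
    and preserves: "distr M M T = M"
    and ergodic: "\<And>A. A \<in> sets M \<Longrightarrow> T -` A \<inter> space M = A \<Longrightarrow>
                    measure M A = 0 \<or> measure M A = 1"

definition koopman :: "('a \<Rightarrow> 'a) \<Rightarrow> ('a \<Rightarrow> real) \<Rightarrow> 'a \<Rightarrow> real" where
  "koopman T g = g \<circ> T"

definition birkhoff_sum :: "('a \<Rightarrow> 'a) \<Rightarrow> nat \<Rightarrow> ('a \<Rightarrow> real) \<Rightarrow> 'a \<Rightarrow> real" where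
  "birkhoff_sum T n g = (\<lambda>\<omega>. \<Sum>j<n. (g \<circ> (T ^^ j)) \<omega>)"

definition iid_vars :: "'a measure \<Rightarrow> 'i set \<Rightarrow> ('i \<Rightarrow> 'a \<Rightarrow> real) \<Rightarrow> bool" where
  "iid_vars M I X \<longleftrightarrow>
     prob_space.indep_vars M (\<lambda>_. borel) X I \<and>
     (\<forall>i\<in>I. \<forall>j\<in>I. distr M borel (X i) = distr M borel (X j))"

text \<open>Independence of two (possibly empty) families of real random variables means independence
  of the random vectors they form. Since \<^const>\<open>prob_space.indep_var\<close> takes both variables with
  values in the same type, both families are indexed by subsets of one index type.\<close>

definition indep_families ::
    "'a measure \<Rightarrow> ('i \<Rightarrow> 'a \<Rightarrow> real) \<Rightarrow> 'i set \<Rightarrow> 'i set \<Rightarrow> bool" where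
  "indep_families M X I J \<longleftrightarrow>
     prob_space.indep_var M
       (PiM I (\<lambda>_. borel)) (\<lambda>\<omega>. \<lambda>i\<in>I. X i \<omega>)
       (PiM J (\<lambda>_. borel)) (\<lambda>\<omega>. \<lambda>j\<in>J. X j \<omega>)"

definition L2_fun :: "'a measure \<Rightarrow> ('a \<Rightarrow> real) \<Rightarrow> bool" where
  "L2_fun M g \<longleftrightarrow> g \<in> borel_measurable M \<and> integrable M (\<lambda>\<omega>. (g \<omega>)\<^sup>2)"

definition L2_tendsto :: "'a measure \<Rightarrow> (nat \<Rightarrow> 'a \<Rightarrow> real) \<Rightarrow> ('a \<Rightarrow> real) \<Rightarrow> bool" where
  "L2_tendsto M g h \<longleftrightarrow>
     (\<forall>n. L2_fun M (g n)) \<and> L2_fun M h \<and>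
     (\<lambda>n. LINT \<omega>|M. (g n \<omega> - h \<omega>)\<^sup>2) \<longlonglongrightarrow> 0"

definition p_seq :: "nat \<Rightarrow> nat" where
  "p_seq k = (if even k then 2 ^ k else 2 ^ (k - 1) + 1)"

definition d_seq :: "nat \<Rightarrow> nat" where
  "d_seq k = 2 ^ (k\<^sup>2)"

definition alpha_seq :: "nat \<Rightarrow> real" where
  "alpha_seq k = 1 / (real (p_seq k) * sqrt (real k * log 2 (real k)))"

definition f_block :: "('a \<Rightarrow> 'a) \<Rightarrow> (nat \<Rightarrow> 'a \<Rightarrow> real) \<Rightarrow> nat \<Rightarrow> 'a \<Rightarrow> real" where
  "f_block T fbar k =
     (let h = (\<lambda>\<omega>. \<Sum>i<p_seq k. (koopman T ^^ i) (fbar k) \<omega>)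
      in (\<lambda>\<omega>. h \<omega> - (koopman T ^^ d_seq k) h \<omega>))"

definition sigma_sq :: real where
  "sigma_sq = 2 * (ln 2)\<^sup>2"

end

(* For n fixed, let K be the largest index with d_K <= 2n. The blocks f_k with k <= K are
   coboundaries whose transfer functions have norm o(sqrt n), while for k > K the sums S_n(f_k) are
   independent of each other and of the first part, with an explicit characteristic function, a
   finite product of factors 1 - alpha_k^2 (1 - cos (t w)). Only the blocks with k between
   sqrt(log n) and (log n)/4 contribute in the limit, and their variances 2 n / (k log k) add up to
   n * 2 (ln 2)^2. By Fourier inversion the local limit theorem follows from this central limit
   statement together with a bound D / (1 + n t^2) for the characteristic function on [-pi, pi].
   For |t| <= n^(-1/4) the bound comes from the variance; for larger t it comes from two consecutive
   blocks with p_(k+1) = p_k + 1, which cannot both have t p close to a multiple of 2 pi. *)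

theory Submission
  imports Defs "HOL-Real_Asymp.Real_Asymp"
begin

section \<open>Fourier inversion for integer-valued variables\<close>

text \<open>The lower threshold is forced: block \<open>k\<close> is controlled only on a time
  window of length about \<open>2 * d_k\<close>, so for \<open>n\<close> well above
  \<open>d_k\<close> the law of \<open>S_n(f_k)\<close> is not determined and only telescoping
  remains. Since \<open>d_k = 2^(k^2)\<close>, this happens for \<open>k\<close> up to about
  \<open>sqrt (log n)\<close>; the upper end of the main range makes \<open>p_k <= n^(1/4)\<close>.
  The sum of \<open>1 / (k * log k)\<close> over that range is \<open>ln 2\<close> times an
  increment of \<open>ln (ln k)\<close>, and the increment tends to \<open>ln 2\<close>. The factor
  2 in the variance counts the two independent copies inside \<open>f_k\<close>. Multiplying an end
  point by a constant changes \<open>ln ln\<close> by o(1), so the blocks near \<open>log n\<close>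
  do not matter. Pointwise convergence of characteristic functions gives only a central limit
  theorem; the obstacle is periodicity. With \<open>p_k = 2^k\<close> throughout,
  \<open>t * p_k\<close> would be a multiple of \<open>2 * pi\<close> at \<open>t = pi\<close>, all
  interior factors would equal 1 and the decay would fail. The pair that repairs this is taken just
  above the lower threshold, where \<open>alpha_k^2\<close> is still
  \<open>2^(-O(sqrt (log n)))\<close>; hence \<open>n * alpha_k^2 * t^2\<close> exceeds a power of
  \<open>n\<close> for all \<open>t\<close> above \<open>n^(-1/4)\<close>.\<close>

lemma integral_cos_int:
  "(LBINT t:{-pi..pi}. cos (t * of_int m)) = (if m = 0 then 2 * pi else 0)"
proof (cases "m = 0")
  case True
  then show ?thesis by (simp add: set_integral_const)
next
  case False
  define F where "F = (\<lambda>t. sin (t * real_of_int m) / of_int m)"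
  have "(LBINT t:{-pi..pi}. cos (t * of_int m)) = F pi - F (-pi)"
    unfolding set_lebesgue_integral_def
  proof (rule integral_FTC_Icc)
    show "(F has_vector_derivative cos (x * real_of_int m)) (at x within {- pi..pi})" for x
      unfolding F_def has_real_derivative_iff_has_vector_derivative[symmetric]
      using False by (auto intro!: derivative_eq_intros)
  qed (auto intro!: continuous_intros)
  also have "\<dots> = 0"
    using False sin_zero_iff_int2[of "pi * of_int m"] by (auto simp: F_def)
  finally show ?thesis using False by simp
qed

lemma integrable_inverse_1_plus_square_real:
  "integrable lborel (\<lambda>s::real. 1 / (1 + s\<^sup>2))"
  using integrable_inverse_1_plus_square
  by (simp add: set_integrable_def einterval_def inverse_eq_divide)

text \<open>Fubini: integrating \<open>cos (t * (X - x))\<close> over \<open>[-pi, pi]\<close> first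
  in \<open>t\<close> gives \<open>2 * pi\<close> times the indicator of \<open>X = x\<close>, as
  \<open>X\<close> is an integer almost surely.\<close>

lemma (in prob_space) integer_valued_prob_eq:
  assumes [measurable]: "X \<in> borel_measurable M" and int: "AE \<omega> in M. X \<omega> \<in> \<int>"
  shows "prob {\<omega> \<in> space M. X \<omega> = of_int x} =
    (LBINT t:{-pi..pi}. Re (iexp (- t * of_int x) * char (distr M borel X) t)) / (2 * pi)"
proof -
  interpret P: pair_sigma_finite M lborel ..
  define g where "g = (\<lambda>\<omega> t. indicator {-pi..pi} t *\<^sub>R cos (t * (X \<omega> - of_int x)))"
  have meas [measurable]: "case_prod g \<in> borel_measurable (M \<Otimes>\<^sub>M lborel)"
    unfolding g_def by measurable
  have bnd: "norm (g \<omega> t) \<le> indicator {-pi..pi} t" for \<omega> t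
    by (auto simp: g_def indicator_def)
  have int_ind: "integrable lborel (\<lambda>t. indicator {-pi..pi} t :: real)" by simp
  have g_int: "integrable lborel (g \<omega>)" if "\<omega> \<in> space M" for \<omega>
    by (rule Bochner_Integration.integrable_bound[OF int_ind]) (use bnd in \<open>auto simp: g_def\<close>)
  have g_pair: "integrable (M \<Otimes>\<^sub>M lborel) (case_prod g)"
  proof (rule P.Fubini_integrable)
    show "AE \<omega> in M. integrable lborel (\<lambda>y. case (\<omega>, y) of (x, xa) \<Rightarrow> g x xa)"
      using g_int by auto
    have "norm (\<integral>y. norm (g \<omega> y) \<partial>lborel) \<le> 2 * pi" if "\<omega> \<in> space M" for \<omega>
    proof -
      have "(\<integral>y. norm (g \<omega> y) \<partial>lborel) \<le> (\<integral>y. indicator {-pi..pi} y \<partial>lborel)"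
        by (intro integral_mono bnd int_ind integrable_norm g_int that)
      then show ?thesis by (simp add: integral_nonneg_AE)
    qed
    then show "integrable M (\<lambda>x. \<integral>y. norm (case (x, y) of (x, xa) \<Rightarrow> g x xa) \<partial>lborel)"
      by (intro integrable_const_bound[where B="2*pi"]) auto
  qed (rule meas)
  have inner1: "(\<integral>\<omega>. g \<omega> t \<partial>M) =
      indicator {-pi..pi} t *\<^sub>R Re (iexp (- t * of_int x) * char (distr M borel X) t)" for t
  proof -
    have I: "integrable M (\<lambda>\<omega>. iexp (t * X \<omega>))"
      by (intro integrable_const_bound[where B=1]) auto
    have "iexp (- t * of_int x) * char (distr M borel X) t
        = (CLINT \<omega>|M. iexp (- t * of_int x) * iexp (t * X \<omega>))"
      using I by (simp add: char_def integral_distr)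
    also have "Re \<dots> = (\<integral>\<omega>. Re (iexp (- t * of_int x) * iexp (t * X \<omega>)) \<partial>M)"
      using integral_Re[OF integrable_mult_right[OF I, of "iexp (- t * of_int x)"]] by simp
    also have "\<dots> = (\<integral>\<omega>. cos (t * (X \<omega> - of_int x)) \<partial>M)"
      by (simp add: exp_add[symmetric] Re_exp algebra_simps)
    finally show ?thesis by (simp add: g_def)
  qed
  have inner2: "(\<integral>t. g \<omega> t \<partial>lborel) = 2 * pi * indicator {\<omega> \<in> space M. X \<omega> = of_int x} \<omega>"
    if "X \<omega> \<in> \<int>" "\<omega> \<in> space M" for \<omega>
  proof -
    from that(1) obtain m where m: "X \<omega> = of_int m" by (auto elim: Ints_cases)
    have "(\<integral>t. g \<omega> t \<partial>lborel) = (LBINT t:{-pi..pi}. cos (t * of_int (m - x)))"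
      by (simp add: g_def m set_lebesgue_integral_def)
    then show ?thesis
      using that(2) by (subst (asm) integral_cos_int) (auto simp: m indicator_def)
  qed
  have "(LBINT t:{-pi..pi}. Re (iexp (- t * of_int x) * char (distr M borel X) t))
      = (\<integral>t. (\<integral>\<omega>. g \<omega> t \<partial>M) \<partial>lborel)"
    unfolding inner1 set_lebesgue_integral_def ..
  also have "\<dots> = (\<integral>\<omega>. (\<integral>t. g \<omega> t \<partial>lborel) \<partial>M)"
    by (rule P.Fubini_integral[OF g_pair])
  also have "\<dots> = (\<integral>\<omega>. 2 * pi * indicator {\<omega> \<in> space M. X \<omega> = of_int x} \<omega> \<partial>M)"
    using int by (intro integral_cong_AE) (auto intro: inner2)
  also have "\<dots> = 2 * pi * prob {\<omega> \<in> space M. X \<omega> = of_int x}"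
    by simp
  finally show ?thesis by simp
qed

text \<open>The characteristic function of the standard normal law is again Gaussian, so evaluating
  it at \<open>- (y / r)\<close> with \<open>r = sqrt v\<close> and substituting
  \<open>u = r * s\<close> already yields the inversion formula.\<close>

lemma normal_density_inversion:
  assumes v: "v > (0::real)"
  shows "integrable lborel (\<lambda>s. exp (- (v * s\<^sup>2 / 2)))"
    and "(\<integral>s. Re (iexp (- s * y) * exp (- (v * s\<^sup>2 / 2))) \<partial>lborel) / (2 * pi)
         = exp (- (y\<^sup>2 / (2 * v))) / sqrt (2 * pi * v)"
proof -
  define r where "r = sqrt v"
  have r: "r > 0" "r\<^sup>2 = v" using v by (auto simp: r_def)
  have std: "std_normal_density = (\<lambda>u. exp (- (u\<^sup>2 / 2)) / sqrt (2 * pi))"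
    by (auto simp: std_normal_density_def fun_eq_iff field_simps)
  have "integrable lborel (\<lambda>s. std_normal_density (0 + r * s))"
    using r by (intro lborel_integrable_real_affine) auto
  then have "integrable lborel (\<lambda>s. sqrt (2*pi) * std_normal_density (0 + r * s))"
    by (rule integrable_mult_right)
  moreover have e: "sqrt (2*pi) * std_normal_density (0 + r * s) = exp (- (v * s\<^sup>2 / 2))" for s
    using r by (simp add: std power_mult_distrib)
  ultimately show int: "integrable lborel (\<lambda>s. exp (- (v * s\<^sup>2 / 2)))" unfolding e by -
  have I: "integrable lborel (\<lambda>u. complex_of_real (std_normal_density u) * iexp (- (y/r) * u))"
  proof (rule Bochner_Integration.integrable_bound)
    show "integrable lborel std_normal_density" by simp
    show "AE x in lborel. cmod (complex_of_real (std_normal_density x) * iexp (- (y/r) * x)) \<le> norm (std_normal_density x)"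
      by (auto simp: norm_mult simp del: of_real_mult)
  qed simp
  have "complex_of_real (exp (- ((y/r)\<^sup>2 / 2))) = char std_normal_distribution (- (y/r))"
    by (simp add: char_std_normal_distribution)
  also have "\<dots> = (CLBINT u. complex_of_real (std_normal_density u) * iexp (- (y/r) * u))"
    unfolding char_def
    by (subst integral_density) (auto simp: scaleR_conv_of_real)
  finally have "exp (- ((y/r)\<^sup>2 / 2))
     = Re (CLBINT u. complex_of_real (std_normal_density u) * iexp (- (y/r) * u))"
    by (metis Re_complex_of_real)
  also have "\<dots> = (LBINT u. Re (complex_of_real (std_normal_density u) * iexp (- (y/r) * u)))"
    using integral_Re[OF I] by simp
  also have "\<dots> = r * (LBINT s. Re (complex_of_real (std_normal_density (0 + r * s)) * iexp (- (y/r) * (0 + r * s))))"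
    using r by (subst lborel_integral_real_affine[of r _ 0]) auto
  also have "(\<lambda>s. Re (complex_of_real (std_normal_density (0 + r * s)) * iexp (- (y/r) * (0 + r * s))))
     = (\<lambda>s. Re (iexp (- s * y) * exp (- (v * s\<^sup>2 / 2))) / sqrt (2*pi))"
    using r by (auto simp: fun_eq_iff std power_mult_distrib Re_exp mult.commute)
  also have "(LBINT s. Re (iexp (- s * y) * exp (- (v * s\<^sup>2 / 2))) / sqrt (2*pi))
     = (LBINT s. Re (iexp (- s * y) * exp (- (v * s\<^sup>2 / 2)))) / sqrt (2*pi)"
    by (rule integral_divide_zero)
  finally have fin: "exp (- ((y/r)\<^sup>2 / 2)) =
      r * ((LBINT s. Re (iexp (- s * y) * exp (- (v * s\<^sup>2 / 2)))) / sqrt (2*pi))" .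
  have e1: "(y/r)\<^sup>2 / 2 = y\<^sup>2 / (2 * v)"
    using r by (simp add: power_divide mult.commute)
  have e2: "sqrt (2 * pi * v) = sqrt (2 * pi) * r"
    unfolding r_def by (rule real_sqrt_mult)
  have e3: "2 * pi = sqrt (2 * pi) * sqrt (2 * pi)" by simp
  have e4: "J / (Q * Q) = e / (Q * r)" if "e = r * (J / Q)" "Q > 0" for e J Q
    using that r by simp
  show "(\<integral>s. Re (iexp (- s * y) * exp (- (v * s\<^sup>2 / 2))) \<partial>lborel) / (2 * pi)
         = exp (- (y\<^sup>2 / (2 * v))) / sqrt (2 * pi * v)"
    unfolding e2 by (subst e3, rule e4[OF fin[unfolded e1]]) simp
qed

text \<open>After \<open>t = s / sqrt n\<close> both terms are Fourier integrals with the same phase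
  of modulus 1. Their difference is at most the \<open>L1\<close> norm of the difference of the
  transforms, which does not involve \<open>x\<close>; this is where the uniformity comes
  from.\<close>

theorem (in prob_space) local_limit_criterion:
  fixes X :: "nat \<Rightarrow> 'a \<Rightarrow> real"
  assumes X: "\<And>n. X n \<in> borel_measurable M"
    and int: "\<And>n. AE \<omega> in M. X n \<omega> \<in> \<int>"
    and v: "v > 0"
    and lim: "\<And>s. (\<lambda>n. char (distr M borel (X n)) (s / sqrt n)) \<longlonglongrightarrow> exp (- (v * s\<^sup>2 / 2))"
    and dom: "\<forall>\<^sub>F n in sequentially. \<forall>t::real. \<bar>t\<bar> \<le> pi \<longrightarrow>
        norm (char (distr M borel (X n)) t) \<le> D / (1 + real n * t\<^sup>2)"
  shows "(\<lambda>n. SUP x::int. \<bar>sqrt (real n) * prob {\<omega> \<in> space M. X n \<omega> = of_int x}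
             - exp (- ((of_int x)\<^sup>2 / (2 * real n * v))) / sqrt (2 * pi * v)\<bar>) \<longlonglongrightarrow> 0"
proof -
  define \<phi> where "\<phi> n t = char (distr M borel (X n)) t" for n t
  have [measurable]: "\<phi> n \<in> borel_measurable borel" for n
    unfolding \<phi>_def by (intro real_distribution.char_measurable real_distribution_distr X)
  define G where "G s = exp (- (v * s\<^sup>2 / 2))" for s
  have [measurable]: "G \<in> borel_measurable borel" unfolding G_def by measurable
  define A where "A n = {- (pi * sqrt (real n)) .. pi * sqrt (real n)}" for n :: nat
  have [measurable]: "A n \<in> sets borel" for n by (simp add: A_def)
  define E where "E n s = indicator (A n) s *\<^sub>R \<phi> n (s / sqrt n) - complex_of_real (G s)" for n s
  have [measurable]: "E n \<in> borel_measurable borel" for n unfolding E_def by measurable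
  have G_int: "integrable lborel G"
    unfolding G_def by (rule normal_density_inversion(1)[OF v])
  \<comment> \<open>The first summand is \<open>D / (1 + n * t^2)\<close> in the scaled variable;
    the hypothesis has this shape in order to be integrable in \<open>s\<close>, uniformly in
    \<open>n\<close>.\<close>
  define W where "W s = \<bar>D\<bar> * (1 / (1 + s\<^sup>2)) + G s" for s
  have W_int: "integrable lborel W"
    unfolding W_def
    by (intro Bochner_Integration.integrable_add integrable_mult_right integrable_inverse_1_plus_square_real G_int)
  have E_W: "\<forall>\<^sub>F n in sequentially. \<forall>s. norm (E n s) \<le> W s"
    using dom eventually_gt_at_top[of 0]
  proof eventually_elim
    case (elim n)
    show ?case
    proof
      fix s
      have "norm (indicator (A n) s *\<^sub>R \<phi> n (s / sqrt n)) \<le> \<bar>D\<bar> * (1 / (1 + s\<^sup>2))"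
      proof (cases "s \<in> A n")
        case True
        then have "\<bar>s / sqrt n\<bar> \<le> pi"
          using elim(2) by (auto simp: A_def field_simps abs_le_iff)
        with elim(1) have "norm (\<phi> n (s / sqrt n)) \<le> D / (1 + n * (s / sqrt n)\<^sup>2)"
          unfolding \<phi>_def by blast
        also have "n * (s / sqrt n)\<^sup>2 = s\<^sup>2"
          using elim(2) by (simp add: power_divide)
        also have "D / (1 + s\<^sup>2) \<le> \<bar>D\<bar> * (1 / (1 + s\<^sup>2))"
          by (simp add: divide_right_mono add_pos_nonneg less_imp_le)
        finally show ?thesis using True by simp
      qed (simp add: add_nonneg_nonneg)
      moreover have "norm (complex_of_real (G s)) = G s" by (simp add: G_def)
      ultimately show "norm (E n s) \<le> W s"
        unfolding E_def W_def using norm_triangle_ineq4 by (metis add_mono order_refl order_trans)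
    qed
  qed
  have "(\<lambda>n. \<integral>s. norm (E n s) \<partial>lborel) \<longlonglongrightarrow> (\<integral>s. 0 \<partial>(lborel::real measure))"
  proof -
    obtain N where N: "\<And>n s. n \<ge> N \<Longrightarrow> norm (E n s) \<le> W s"
      using E_W by (auto simp: eventually_sequentially)
    have "(\<lambda>n. \<integral>s. norm (E (n + N) s) \<partial>lborel) \<longlonglongrightarrow> (\<integral>s. 0 \<partial>(lborel::real measure))"
    proof (rule integral_dominated_convergence[OF _ _ W_int])
      show "AE s in lborel. (\<lambda>n. norm (E (n + N) s)) \<longlonglongrightarrow> 0"
      proof (rule AE_I2)
        fix s :: real
        have "filterlim (\<lambda>n. pi * sqrt (real n)) at_top sequentially"
          by real_asymp
        then have "\<forall>\<^sub>F n in sequentially. pi * sqrt (real n) \<ge> \<bar>s\<bar>"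
          by (simp add: filterlim_at_top)
        then have "\<forall>\<^sub>F n in sequentially. \<phi> n (s / sqrt n) - G s = E n s"
          by eventually_elim (auto simp: E_def A_def indicator_def)
        moreover have "(\<lambda>n. \<phi> n (s / sqrt n) - G s) \<longlonglongrightarrow> 0"
          using lim[of s] unfolding \<phi>_def G_def
          by (rule LIM_zero)
        ultimately have "(\<lambda>n. E n s) \<longlonglongrightarrow> 0"
          by (rule Lim_transform_eventually[rotated])
        then show "(\<lambda>n. norm (E (n + N) s)) \<longlonglongrightarrow> 0"
          by (intro tendsto_norm_zero LIMSEQ_ignore_initial_segment)
      qed
    qed (use N in auto)
    then show ?thesis by (rule LIMSEQ_offset)
  qed
  then have lim0: "(\<lambda>n. (\<integral>s. norm (E n s) \<partial>lborel) / (2 * pi)) \<longlonglongrightarrow> 0"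
    by (simp add: tendsto_divide_zero)
  have bound: "\<forall>\<^sub>F n in sequentially. \<forall>x::int.
     \<bar>sqrt (real n) * prob {\<omega> \<in> space M. X n \<omega> = of_int x}
             - exp (- ((of_int x)\<^sup>2 / (2 * real n * v))) / sqrt (2 * pi * v)\<bar>
       \<le> (\<integral>s. norm (E n s) \<partial>lborel) / (2 * pi)"
    using E_W eventually_gt_at_top[of 0]
  proof eventually_elim
    case (elim n)
    have E_int: "integrable lborel (E n)"
      by (rule Bochner_Integration.integrable_bound[OF W_int]) (use elim(1) in \<open>auto intro!: AE_I2 intro: order_trans[OF _ abs_ge_self]\<close>)
    have C_int: "integrable lborel (\<lambda>s. complex_of_real (G s))"
      using G_int by simp
    show ?case
    proof
      fix x :: int
      define y where "y = of_int x / sqrt (real n)"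
      have sn: "sqrt (real n) > 0" using elim(2) by simp
      have mult_int: "integrable lborel (\<lambda>s. iexp (- s * y) * h s)" if "integrable lborel h"
        for h :: "real \<Rightarrow> complex"
        by (rule Bochner_Integration.integrable_bound[OF that])
           (use borel_measurable_integrable[OF that] in \<open>auto simp: norm_mult simp del: of_real_mult\<close>)
      have 1: "sqrt (real n) * prob {\<omega> \<in> space M. X n \<omega> = of_int x}
         = (\<integral>s. Re (iexp (- s * y) * (indicator (A n) s *\<^sub>R \<phi> n (s / sqrt n))) \<partial>lborel) / (2 * pi)"
      proof -
        have "sqrt (real n) * prob {\<omega> \<in> space M. X n \<omega> = of_int x}
           = sqrt (real n) * (\<integral>t. indicator {-pi..pi} t *\<^sub>R Re (iexp (- t * of_int x) * \<phi> n t) \<partial>lborel) / (2 * pi)"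
          unfolding integer_valued_prob_eq[OF X int] \<phi>_def set_lebesgue_integral_def by simp
        also have "(\<integral>t. indicator {-pi..pi} t *\<^sub>R Re (iexp (- t * of_int x) * \<phi> n t) \<partial>lborel)
          = \<bar>1 / sqrt (real n)\<bar> *\<^sub>R (\<integral>s. indicator {-pi..pi} (0 + 1 / sqrt (real n) * s) *\<^sub>R
              Re (iexp (- (0 + 1 / sqrt (real n) * s) * of_int x) * \<phi> n (0 + 1 / sqrt (real n) * s)) \<partial>lborel)"
          using sn by (intro lborel_integral_real_affine) auto
        also have "(\<lambda>s. indicator {-pi..pi} (0 + 1 / sqrt (real n) * s) *\<^sub>R
              Re (iexp (- (0 + 1 / sqrt (real n) * s) * of_int x) * \<phi> n (0 + 1 / sqrt (real n) * s)))
           = (\<lambda>s. Re (iexp (- s * y) * (indicator (A n) s *\<^sub>R \<phi> n (s / sqrt n))))"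
          using sn by (auto simp: fun_eq_iff A_def y_def indicator_def field_simps)
        finally show ?thesis using sn by simp
      qed
      have 2: "exp (- ((of_int x)\<^sup>2 / (2 * real n * v))) / sqrt (2 * pi * v)
         = (\<integral>s. Re (iexp (- s * y) * G s) \<partial>lborel) / (2 * pi)"
        using normal_density_inversion(2)[OF v, of y] elim(2)
        by (simp add: G_def y_def power_divide field_simps)
      have e: "(\<lambda>s. indicator (A n) s *\<^sub>R \<phi> n (s / sqrt n)) = (\<lambda>s. E n s + G s)"
        by (simp add: E_def fun_eq_iff)
      have int1: "integrable lborel (\<lambda>s. Re (iexp (- s * y) * (indicator (A n) s *\<^sub>R \<phi> n (s / sqrt n))))"
        unfolding e[THEN fun_cong]
        by (intro integrable_Re mult_int Bochner_Integration.integrable_add E_int C_int)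
      have "sqrt (real n) * prob {\<omega> \<in> space M. X n \<omega> = of_int x}
             - exp (- ((of_int x)\<^sup>2 / (2 * real n * v))) / sqrt (2 * pi * v)
         = (\<integral>s. Re (iexp (- s * y) * (indicator (A n) s *\<^sub>R \<phi> n (s / sqrt n)))
              - Re (iexp (- s * y) * G s) \<partial>lborel) / (2 * pi)"
        unfolding 1 2 
        by (subst Bochner_Integration.integral_diff[OF int1 integrable_Re[OF mult_int[OF C_int]]])
           (simp only: diff_divide_distrib)
      also have "(\<lambda>s. Re (iexp (- s * y) * (indicator (A n) s *\<^sub>R \<phi> n (s / sqrt n)))
              - Re (iexp (- s * y) * G s)) = (\<lambda>s. Re (iexp (- s * y) * E n s))"
        unfolding E_def minus_complex.sel(1)[symmetric] right_diff_distrib[symmetric] ..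
      finally have 3: "sqrt (real n) * prob {\<omega> \<in> space M. X n \<omega> = of_int x}
             - exp (- ((of_int x)\<^sup>2 / (2 * real n * v))) / sqrt (2 * pi * v)
         = (\<integral>s. Re (iexp (- s * y) * E n s) \<partial>lborel) / (2 * pi)" .
      have "\<bar>\<integral>s. Re (iexp (- s * y) * E n s) \<partial>lborel\<bar> \<le> (\<integral>s. norm (E n s) \<partial>lborel)"
      proof (rule order_trans[OF integral_abs_bound integral_mono])
        show "\<bar>Re (iexp (- s * y) * E n s)\<bar> \<le> norm (E n s)" for s
          using abs_Re_le_cmod[of "iexp (- s * y) * E n s"]
          by (simp add: norm_mult del: times_complex.sel of_real_mult)
      qed (intro integrable_abs integrable_Re mult_int E_int integrable_norm)+
      then show "\<bar>sqrt (real n) * prob {\<omega> \<in> space M. X n \<omega> = of_int x}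
             - exp (- ((of_int x)\<^sup>2 / (2 * real n * v))) / sqrt (2 * pi * v)\<bar>
       \<le> (\<integral>s. norm (E n s) \<partial>lborel) / (2 * pi)"
        unfolding 3 by (simp add: divide_right_mono)
    qed
  qed
  show ?thesis
  proof (rule tendsto_sandwich[OF _ _ tendsto_const lim0])
    show "\<forall>\<^sub>F n in sequentially. (SUP x::int. \<bar>sqrt (real n) * prob {\<omega> \<in> space M. X n \<omega> = of_int x}
             - exp (- ((of_int x)\<^sup>2 / (2 * real n * v))) / sqrt (2 * pi * v)\<bar>) \<le> (\<integral>s. norm (E n s) \<partial>lborel) / (2 * pi)"
      using bound by eventually_elim (rule cSUP_least, auto)
    show "\<forall>\<^sub>F n in sequentially. 0 \<le> (SUP x::int. \<bar>sqrt (real n) * prob {\<omega> \<in> space M. X n \<omega> = of_int x}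
             - exp (- ((of_int x)\<^sup>2 / (2 * real n * v))) / sqrt (2 * pi * v)\<bar>)"
      using bound
    proof eventually_elim
      case (elim n)
      \<comment> \<open>A real supremum dominates the members of its family only when the family is
        bounded above; \<open>bound\<close> supplies this.\<close>
      then show ?case
        by (intro cSUP_upper2[where x=0]) (auto intro!: bdd_aboveI2)
    qed
  qed
qed

section \<open>Characteristic functions of weighted sums\<close>

text \<open>The multiplicity of \<open>m\<close> among the sums \<open>i + j\<close> with \<open>i < p\<close> and \<open>j < n\<close>.\<close>

definition overlap :: "nat \<Rightarrow> nat \<Rightarrow> nat \<Rightarrow> nat" where
  "overlap p n m = card {j. j < n \<and> j \<le> m \<and> m < j + p}"

lemma double_sum_overlap:
  fixes g :: "nat \<Rightarrow> real"
  shows "(\<Sum>j<n. \<Sum>i<p. g (i + j)) = (\<Sum>m<n+p. real (overlap p n m) * g m)"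
proof -
  have "(\<Sum>j<n. \<Sum>i<p. g (i + j)) = (\<Sum>j<n. \<Sum>m<n+p. if j \<le> m \<and> m < j + p then g m else 0)"
  proof (rule sum.cong[OF refl])
    fix j assume "j \<in> {..<n}"
    have "(\<Sum>i<p. g (i + j)) = sum g {j..<j+p}"
      by (rule sum.reindex_bij_witness[of _ "\<lambda>m. m - j" "\<lambda>i. i + j"]) auto
    also have "{j..<j+p} = {m \<in> {..<n+p}. j \<le> m \<and> m < j + p}"
      using \<open>j \<in> {..<n}\<close> by auto
    finally show "(\<Sum>i<p. g (i + j)) = (\<Sum>m<n+p. if j \<le> m \<and> m < j + p then g m else 0)"
      by (subst sum.inter_filter[symmetric]) auto
  qed
  also have "\<dots> = (\<Sum>m<n+p. \<Sum>j<n. if j \<le> m \<and> m < j + p then g m else 0)"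
    by (rule sum.swap)
  also have "\<dots> = (\<Sum>m<n+p. real (overlap p n m) * g m)"
    by (subst sum.inter_filter[symmetric]) (auto simp: overlap_def)
  finally show ?thesis .
qed

lemma overlap_le1: "overlap p n m \<le> p"
proof -
  have "overlap p n m \<le> card {m + 1 - p..m}"
    unfolding overlap_def by (rule card_mono) auto
  then show ?thesis by simp
qed

lemma overlap_le2: "overlap p n m \<le> n"
proof -
  have "overlap p n m \<le> card {..<n}"
    unfolding overlap_def by (rule card_mono) auto
  then show ?thesis by simp
qed

lemma sum_overlap: "(\<Sum>m<n+p. real (overlap p n m)) = real n * real p"
  using double_sum_overlap[of "\<lambda>_. 1" p n] by simp

lemma overlap_eq: "p \<le> m \<Longrightarrow> m < n \<Longrightarrow> overlap p n m = p"
proof -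
  assume "p \<le> m" "m < n"
  then have "{j. j < n \<and> j \<le> m \<and> m < j + p} = {m + 1 - p..m}" by auto
  with \<open>p \<le> m\<close> show ?thesis by (simp add: overlap_def)
qed

lemma one_minus_cos_le: "1 - cos u \<le> u\<^sup>2 / 2" for u :: real
proof -
  have "1 - cos u = 2 * (sin (u / 2))\<^sup>2"
    using cos_double_sin[of "u/2"] by simp
  also have "(sin (u/2))\<^sup>2 \<le> (u / 2)\<^sup>2"
    using abs_sin_x_le_abs_x[of "u/2"] by (simp only: abs_le_square_iff)
  finally show ?thesis by (simp add: power_divide)
qed

text \<open>Third order Taylor expansion of the exponential: the remainder \<open>u^4 / 24\<close>
  is exactly the loss \<open>u^2 / 2 * (u^2 / 12)\<close>.\<close>

lemma one_minus_cos_ge: "1 - cos u \<ge> u\<^sup>2 / 2 * (1 - u\<^sup>2 / 12)" for u :: real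
proof -
  have "Re (iexp u - (\<Sum>k\<le>3. (\<i> * complex_of_real u) ^ k / fact k)) \<le> \<bar>u\<bar> ^ Suc 3 / fact (Suc 3)"
    by (rule order_trans[OF complex_Re_le_cmod iexp_approx1])
  then show ?thesis
    by (simp add: Re_exp numeral_eq_Suc fact_Suc power_mult_distrib abs_mult_self_eq mult.assoc[symmetric])
       (simp add: algebra_simps)
qed

text \<open>With \<open>P(Y = 1) = P(Y = -1) = a / 2\<close> and \<open>P(Y = 0) = 1 - a\<close> each factor is the
  characteristic function of \<open>Y\<close> at \<open>t * overlap p n m\<close>.\<close>

definition block_char :: "real \<Rightarrow> nat \<Rightarrow> nat \<Rightarrow> real \<Rightarrow> real" where
  "block_char a p n t = (\<Prod>m<n+p. 1 - a * (1 - cos (t * overlap p n m)))"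

context
  fixes a :: real
  assumes a: "0 \<le> a" "a \<le> 1/2"
begin

text \<open>As \<open>1 - cos u <= 2\<close>, the bound \<open>a <= 1 / 2\<close> places every
  factor of \<open>block_char\<close> in \<open>[0, 1]\<close>, on which the product estimates
  rest.\<close>

lemma factor_bounds: "0 \<le> a * (1 - cos u)" "a * (1 - cos u) \<le> 1"
proof -
  show "0 \<le> a * (1 - cos u)" using a by simp
  have "a * (1 - cos u) \<le> 1/2 * 2" using a by (intro mult_mono) (auto simp: cos_ge_minus_one le_diff_eq)
  then show "a * (1 - cos u) \<le> 1" by simp
qed

lemma block_char_bounds: "0 \<le> block_char a p n t" "block_char a p n t \<le> 1"
  unfolding block_char_def using factor_bounds by (auto intro!: prod_nonneg prod_le_1)

text \<open>Quadratic bound on the cosine, then \<open>overlap^2 <= min p n * overlap\<close>, so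
  that only the total mass \<open>n * p\<close> of the overlaps enters. Keeping
  \<open>min p n\<close> pays off for blocks with \<open>p > n\<close>.\<close>

lemma sum_factor_le:
  fixes t :: real
  shows "(\<Sum>m<n+p. a * (1 - cos (t * overlap p n m))) \<le> a * t\<^sup>2 / 2 * min p n * n * p"
proof -
  have "(\<Sum>m<n+p. a * (1 - cos (t * overlap p n m)))
      \<le> (\<Sum>m<n+p. (a * t\<^sup>2 / 2 * min p n) * overlap p n m)"
  proof (rule sum_mono)
    fix m
    have "a * (1 - cos (t * overlap p n m)) \<le> a * ((t * overlap p n m)\<^sup>2 / 2)"
      using a by (intro mult_left_mono one_minus_cos_le) auto
    also have "\<dots> = (a * t\<^sup>2 / 2 * overlap p n m) * overlap p n m"
      by (simp add: power2_eq_square)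
    also have "\<dots> \<le> (a * t\<^sup>2 / 2 * min p n) * overlap p n m"
      using a overlap_le1[of p n m] overlap_le2[of p n m]
      by (intro mult_right_mono mult_left_mono) auto
    finally show "a * (1 - cos (t * overlap p n m)) \<le> (a * t\<^sup>2 / 2 * min p n) * overlap p n m" .
  qed
  also have "\<dots> = a * t\<^sup>2 / 2 * min p n * n * p"
    by (simp only: sum_distrib_left[symmetric] sum_overlap mult.assoc)
  finally show ?thesis .
qed

lemma one_minus_block_char_le: "1 - block_char a p n t \<le> a * t\<^sup>2 / 2 * min p n * n * p"
proof -
  have "1 - (\<Sum>m<n+p. a * (1 - cos (t * overlap p n m))) \<le> block_char a p n t"
    unfolding block_char_def using factor_bounds by (intro Weierstrass_prod_ineq) auto
  with sum_factor_le[where p=p and n=n and t=t] show ?thesis by linarith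
qed

text \<open>The interior indices \<open>p <= m < n\<close> all have overlap exactly \<open>p\<close>
  and give \<open>n - p\<close> equal factors; the boundary factors are bounded by 1.\<close>

lemma block_char_le:
  fixes t :: real
  assumes "p \<le> n"
  shows "block_char a p n t \<le> exp (- ((real n - p) * (a * (1 - cos (t * p)))))"
proof -
  have "block_char a p n t \<le> (\<Prod>m<n+p. if m \<in> {p..<n} then exp (- (a * (1 - cos (t * p)))) else 1)"
    unfolding block_char_def
  proof (rule prod_mono, safe)
    fix m
    show "0 \<le> 1 - a * (1 - cos (t * overlap p n m))" using factor_bounds by simp
    have "1 - x \<le> exp (- x)" for x :: real using exp_ge_add_one_self[of "-x"] by simp
    then show "1 - a * (1 - cos (t * overlap p n m)) \<le> (if m \<in> {p..<n} then exp (- (a * (1 - cos (t * p)))) else 1)"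
      using factor_bounds(1) by (auto simp: overlap_eq)
  qed
  also have "\<dots> = (\<Prod>m\<in>{p..<n}. exp (- (a * (1 - cos (t * p)))))"
  proof -
    have "{..<n+p} \<inter> {m. m \<in> {p..<n}} = {p..<n}" by auto
    then show ?thesis by (simp add: prod.If_cases)
  qed
  also have "\<dots> = exp (- ((real n - p) * (a * (1 - cos (t * p)))))"
    using assms by (simp add: of_nat_diff exp_of_nat_mult[symmetric] del: exp_of_nat_mult)
  finally show ?thesis .
qed

text \<open>Each factor is \<open>1 - x\<close> with \<open>2 * x <= \<delta>\<close> and
  \<open>x <= 1 / 2\<close>, hence
  \<open>ln (1 - x) >= - x - 2 * x^2 >= - (1 + \<delta>) * x\<close>: passing to exponentials costs
  only the relative error \<open>\<delta>\<close>.\<close>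

lemma block_char_ge:
  fixes t :: real
  assumes "a * t\<^sup>2 * (real p)\<^sup>2 \<le> 1"
  shows "block_char a p n t \<ge> exp (- ((1 + a * t\<^sup>2 * (real p)\<^sup>2) * (a * t\<^sup>2 / 2 * n * (real p)\<^sup>2)))"
proof -
  define x where "x m = a * (1 - cos (t * overlap p n m))" for m
  define \<delta> where "\<delta> = a * t\<^sup>2 * (real p)\<^sup>2"
  have x0: "x m \<ge> 0" for m unfolding x_def by (rule factor_bounds)
  have x_le: "x m \<le> \<delta> / 2" for m
  proof -
    have "x m \<le> a * ((t * overlap p n m)\<^sup>2 / 2)"
      unfolding x_def using a by (intro mult_left_mono one_minus_cos_le) auto
    also have "\<dots> = a * t\<^sup>2 / 2 * (real (overlap p n m))\<^sup>2" by (simp add: power_mult_distrib)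
    also have "\<dots> \<le> a * t\<^sup>2 / 2 * (real p)\<^sup>2"
      using a overlap_le1 by (intro mult_left_mono) (auto intro!: power_mono)
    finally show ?thesis by (simp add: \<delta>_def)
  qed
  have "\<delta> \<ge> 0" using a by (simp add: \<delta>_def)
  have "exp (- ((1 + \<delta>) * (a * t\<^sup>2 / 2 * n * (real p)\<^sup>2))) \<le> exp (- ((1 + \<delta>) * (\<Sum>m<n+p. x m)))"
  proof -
    have "(\<Sum>m<n+p. x m) \<le> a * t\<^sup>2 / 2 * min p n * n * p"
      unfolding x_def by (rule sum_factor_le)
    also have "\<dots> \<le> a * t\<^sup>2 / 2 * p * n * p"
      using a by (intro mult_right_mono mult_left_mono) auto
    also have "\<dots> = a * t\<^sup>2 / 2 * n * (real p)\<^sup>2" by (simp add: power2_eq_square)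
    finally have "(\<Sum>m<n+p. x m) \<le> a * t\<^sup>2 / 2 * n * (real p)\<^sup>2" .
    with \<open>\<delta> \<ge> 0\<close> show ?thesis by (simp add: mult_left_mono)
  qed
  also have "\<dots> = (\<Prod>m<n+p. exp (- ((1 + \<delta>) * x m)))"
    by (simp add: exp_sum sum_distrib_left sum_negf[symmetric] del: sum_negf)
  also have "\<dots> \<le> (\<Prod>m<n+p. 1 - x m)"
  proof (rule prod_mono, safe)
    fix m
    have h: "x m \<le> 1/2" using x_le[of m] assms unfolding \<delta>_def by linarith
    have "(2 * x m) * x m \<le> \<delta> * x m"
      using x_le[of m] x0[of m] by (intro mult_right_mono) auto
    then have "- ((1 + \<delta>) * x m) \<le> - x m - 2 * (x m)\<^sup>2"
      by (simp add: power2_eq_square algebra_simps)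
    also have "\<dots> \<le> ln (1 - x m)" using x0 h by (intro ln_one_minus_pos_lower_bound)
    finally have "exp (- ((1 + \<delta>) * x m)) \<le> exp (ln (1 - x m))" by simp
    then show "exp (- ((1 + \<delta>) * x m)) \<le> 1 - x m" using h by simp
  qed simp
  finally show ?thesis unfolding block_char_def x_def \<delta>_def .
qed

end

section \<open>Asymptotics of the main product\<close>

text \<open>For \<open>k >= 2\<close> this is \<open>alpha_k^2 * p_k^2\<close>, the variance per
  step, for \<open>n\<close> large against \<open>p_k\<close>, of one of the two copies in
  \<open>f_k\<close>.\<close>

definition recip_klog :: "nat \<Rightarrow> real" where
  "recip_klog k = 1 / (real k * log 2 (real k))"

lemma log2_ge_1: "k \<ge> 2 \<Longrightarrow> log 2 (real k) \<ge> 1"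
  by (subst le_log_iff) auto

lemma recip_klog_pos: "k \<ge> 2 \<Longrightarrow> recip_klog k > 0"
  using log2_ge_1[of k] by (simp add: recip_klog_def)

lemma recip_klog_antimono: "2 \<le> k \<Longrightarrow> k \<le> l \<Longrightarrow> recip_klog l \<le> recip_klog k"
  unfolding recip_klog_def using log2_ge_1[of k]
  by (intro divide_left_mono mult_mono mult_pos_pos) auto

lemma recip_klog_le: "k \<ge> 2 \<Longrightarrow> recip_klog k \<le> 1 / 2"
  using recip_klog_antimono[of 2 k] by (simp add: recip_klog_def)

lemma p_seq_le: "p_seq k \<le> 2 ^ k" if "k \<ge> 1"
proof -
  from that obtain j where "k = Suc j" by (cases k) auto
  then show ?thesis by (simp add: p_seq_def)
qed

lemma p_seq_ge: "2 ^ k \<le> 2 * p_seq k"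
  by (cases k) (auto simp: p_seq_def)

lemma p_seq_pos: "p_seq k > 0"
  by (simp add: p_seq_def)

lemma p_seq_Suc: "even k \<Longrightarrow> p_seq (Suc k) = Suc (p_seq k)"
  by (simp add: p_seq_def)

lemma alpha_sq: "k \<ge> 2 \<Longrightarrow> (alpha_seq k)\<^sup>2 = recip_klog k / (real (p_seq k))\<^sup>2"
  using log2_ge_1[of k]
  by (simp add: alpha_seq_def recip_klog_def power_divide power_mult_distrib)

lemma alpha_sq_p_sq: "k \<ge> 2 \<Longrightarrow> (alpha_seq k)\<^sup>2 * (real (p_seq k))\<^sup>2 = recip_klog k"
  using p_seq_pos[of k] by (simp add: alpha_sq)

lemma alpha_sq_bounds:
  assumes "k \<ge> 2"
  shows "0 \<le> (alpha_seq k)\<^sup>2" "(alpha_seq k)\<^sup>2 \<le> 1 / 2"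
proof -
  have "real (p_seq k) \<ge> 1" using p_seq_pos[of k] by linarith
  then have "(real (p_seq k))\<^sup>2 \<ge> 1" by simp
  then have "(alpha_seq k)\<^sup>2 * 1 \<le> (alpha_seq k)\<^sup>2 * (real (p_seq k))\<^sup>2"
    by (intro mult_left_mono) auto
  then show "(alpha_seq k)\<^sup>2 \<le> 1 / 2" using alpha_sq_p_sq recip_klog_le assms by force
qed simp

lemma d_seq_ge: "k \<ge> 2 \<Longrightarrow> 2 * p_seq k \<le> d_seq k"
proof -
  assume "k \<ge> 2"
  then have "Suc k \<le> 2 * k" by simp
  also have "\<dots> \<le> k\<^sup>2" using \<open>k \<ge> 2\<close> by (simp add: power2_eq_square)
  finally have "2 ^ Suc k \<le> d_seq k" unfolding d_seq_def by (intro power_increasing) auto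
  moreover have "p_seq k \<le> 2 ^ k" using p_seq_le \<open>k \<ge> 2\<close> by simp
  ultimately show ?thesis by simp
qed

text \<open>Blocks up to \<open>lo n\<close> are treated as coboundaries, blocks above \<open>hi n\<close> as an error term.\<close>

definition lo :: "nat \<Rightarrow> nat" where "lo n = nat \<lfloor>sqrt (log 2 (2 * real n))\<rfloor>"
definition hi :: "nat \<Rightarrow> nat" where "hi n = nat \<lfloor>log 2 (real n) / 4\<rfloor>"

lemma lo_bounds:
  assumes "n \<ge> 1"
  shows "real (lo n) \<le> sqrt (log 2 (2 * real n))" "sqrt (log 2 (2 * real n)) < real (lo n) + 1"
proof -
  have "sqrt (log 2 (2 * real n)) \<ge> 0" using assms by simp
  then show "real (lo n) \<le> sqrt (log 2 (2 * real n))" "sqrt (log 2 (2 * real n)) < real (lo n) + 1"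
    unfolding lo_def by linarith+
qed

lemma hi_bounds:
  assumes "n \<ge> 1"
  shows "real (hi n) \<le> log 2 (real n) / 4" "log 2 (real n) / 4 < real (hi n) + 1"
proof -
  have "log 2 (real n) / 4 \<ge> 0" using assms by simp
  then show "real (hi n) \<le> log 2 (real n) / 4" "log 2 (real n) / 4 < real (hi n) + 1"
    unfolding hi_def by linarith+
qed

lemma lo_at_top: "filterlim lo at_top sequentially"
proof -
  have "filterlim (\<lambda>n. sqrt (log 2 (2 * real n)) - 1) at_top sequentially" by real_asymp
  then have "filterlim (\<lambda>n. real (lo n)) at_top sequentially"
  proof (rule filterlim_at_top_mono)
    show "\<forall>\<^sub>F n in sequentially. sqrt (log 2 (2 * real n)) - 1 \<le> real (lo n)"
      using eventually_ge_at_top[of 1] by eventually_elim (use lo_bounds in force)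
  qed
  then show ?thesis by (simp add: filterlim_sequentially_iff_filterlim_real)
qed

lemma lo_hi: "\<forall>\<^sub>F n in sequentially. lo n + 3 \<le> hi n"
proof -
  have "\<forall>\<^sub>F n in sequentially. sqrt (log 2 (2 * real n)) + 4 \<le> log 2 (real n) / 4" by real_asymp
  then show ?thesis using eventually_ge_at_top[of 1]
  proof eventually_elim
    case (elim n)
    then have "real (lo n + 3) < real (hi n) + 1"
      using lo_bounds[of n] hi_bounds[of n] by simp
    then show ?case by linarith
  qed
qed

lemma hi_at_top: "filterlim hi at_top sequentially"
  by (rule filterlim_at_top_mono[OF lo_at_top]) (use lo_hi in \<open>auto elim: eventually_mono\<close>)

lemma d_seq_powr: "real (d_seq k) = 2 powr real (k\<^sup>2)"
proof -
  have "real (d_seq k) = 2 ^ (k\<^sup>2)" by (simp add: d_seq_def)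
  also have "\<dots> = 2 powr real (k\<^sup>2)" by (rule powr_realpow[symmetric]) simp
  finally show ?thesis .
qed

lemma d_seq_le_lo: "n \<ge> 1 \<Longrightarrow> k \<le> lo n \<Longrightarrow> real (d_seq k) \<le> 2 * real n"
proof -
  assume n: "n \<ge> 1" and "k \<le> lo n"
  then have "real k \<le> sqrt (log 2 (2 * real n))" using lo_bounds(1)[OF n] by linarith
  then have "(real k)\<^sup>2 \<le> log 2 (2 * real n)"
    using n by (metis abs_of_nonneg of_nat_0_le_iff real_sqrt_abs real_sqrt_le_iff)
  then have "2 powr (real (k\<^sup>2)) \<le> 2 * real n"
    using n by (subst (asm) le_log_iff) auto
  then show ?thesis by (simp only: d_seq_powr)
qed

text \<open>Averaged with \<open>2 * p_seq k <= d_seq k\<close> this gives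
  \<open>n + p_seq k <= d_seq k\<close>, so that the two copies in block \<open>k\<close> use
  disjoint times. The factor 2 inside \<open>lo\<close> serves this purpose.\<close>

lemma d_seq_ge_lo: "n \<ge> 1 \<Longrightarrow> lo n < k \<Longrightarrow> 2 * n \<le> d_seq k"
proof -
  assume n: "n \<ge> 1" and "lo n < k"
  then have "sqrt (log 2 (2 * real n)) \<le> real k" using lo_bounds(2)[OF n] by linarith
  then have "log 2 (2 * real n) \<le> (real k)\<^sup>2"
    using sqrt_le_D by blast
  then have "2 * real n \<le> 2 powr (real (k\<^sup>2))"
    using n by (subst (asm) log_le_iff) auto
  then have "real (2 * n) \<le> real (d_seq k)" by (simp add: d_seq_powr)
  then show ?thesis by linarith
qed

text \<open>The reason for the 4 in \<open>hi\<close>: \<open>t * p_seq k\<close> tends to 0 at the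
  scale \<open>t = s / sqrt n\<close> and stays at most 1 up to \<open>|t| = n^(-1/4)\<close>, so
  the quadratic part of the cosine dominates on that whole range.\<close>

lemma p_seq_le_hi:
  assumes "n \<ge> 1" "1 \<le> k" "k \<le> hi n"
  shows "real (p_seq k) \<le> real n powr (1/4)"
proof -
  have "real (p_seq k) \<le> 2 ^ k" using of_nat_mono[OF p_seq_le[OF assms(2)], where ?'a=real] by simp
  also have "\<dots> = 2 powr (real k)" by (simp add: powr_realpow)
  also have "\<dots> \<le> 2 powr (log 2 (real n) / 4)" using hi_bounds(1)[of n] assms by simp
  also have "\<dots> = (2 powr (log 2 (real n))) powr (1/4)" by (simp add: powr_powr)
  also have "\<dots> = real n powr (1/4)" using assms by simp
  finally show ?thesis .
qed

section \<open>The sum of variances over the main range\<close>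

definition klog_sum :: "nat \<Rightarrow> real" where
  "klog_sum n = (\<Sum>k\<in>{lo n<..hi n}. recip_klog k)"

text \<open>The derivative of \<open>ln (ln x)\<close> is \<open>1 / (x * ln x)\<close>, and the
  base of the logarithm contributes \<open>ln 2\<close>. Each increment is compared by means of
  \<open>ln z <= z - 1\<close>, applied to the quotient of consecutive logarithms, and a linear
  bound on \<open>ln (1 + 1 / k)\<close> or \<open>ln (1 - 1 / x)\<close>.\<close>

lemma klog_sum_telescope:
  fixes K L :: nat
  assumes "2 \<le> K" "K \<le> L"
  shows "ln 2 * (ln (ln (real L + 1)) - ln (ln (real K + 1))) \<le> (\<Sum>k\<in>{K<..L}. recip_klog k)"
    and "(\<Sum>k\<in>{K<..L}. recip_klog k) \<le> ln 2 * (ln (ln (real L)) - ln (ln (real K)))"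
proof -
  have eq: "recip_klog k = ln 2 * (1 / (real k * ln (real k)))" for k
    by (simp add: recip_klog_def log_def)
  have up: "ln (ln (real k + 1)) - ln (ln (real k)) \<le> 1 / (real k * ln (real k))" if "k \<ge> 2" for k :: nat
  proof -
    have l: "ln (real k) > 0" "ln (real k + 1) > 0" using that by auto
    have "ln (ln (real k + 1)) - ln (ln (real k)) = ln (ln (real k + 1) / ln (real k))"
      using l by (simp add: ln_div)
    also have "\<dots> \<le> ln (real k + 1) / ln (real k) - 1"
      using l by (intro ln_le_minus_one) auto
    also have "\<dots> = ln (1 + 1 / real k) / ln (real k)"
    proof -
      have "ln (real k + 1) - ln (real k) = ln (1 + 1 / real k)"
        using that ln_div[of "real k + 1" "real k"] by (simp add: add_divide_distrib add.commute)
      then show ?thesis using l by (simp add: field_simps)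
    qed
    also have "\<dots> \<le> (1 / real k) / ln (real k)"
      using l ln_add_one_self_le_self[of "1 / real k"] by (intro divide_right_mono) auto
    finally show ?thesis by simp
  qed
  have dn: "1 / (real (Suc k) * ln (real (Suc k))) \<le> ln (ln (real (Suc k))) - ln (ln (real k))" if "k \<ge> 2" for k :: nat
  proof -
    define x where "x = real k + 1"
    have x: "x > 2" "real k = x - 1" "real (Suc k) = x" using that by (auto simp: x_def)
    have l: "ln x > 0" "ln (x - 1) > 0" using x by auto
    have "ln (ln (x - 1)) - ln (ln x) = ln (ln (x - 1) / ln x)"
      using l by (simp add: ln_div)
    also have "\<dots> \<le> ln (x - 1) / ln x - 1"
      using l by (intro ln_le_minus_one) auto
    also have "\<dots> = ln (1 - 1 / x) / ln x"
    proof -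
      have "ln (x - 1) - ln x = ln (1 - 1 / x)"
        using x ln_div[of "x - 1" x] by (simp add: diff_divide_distrib)
      then show ?thesis using l by (simp add: field_simps)
    qed
    also have "\<dots> \<le> (- (1 / x)) / ln x"
      using l x ln_le_minus_one[of "1 - 1 / x"] by (intro divide_right_mono) auto
    finally show ?thesis unfolding x(2,3) by simp
  qed
  show "ln 2 * (ln (ln (real L + 1)) - ln (ln (real K + 1))) \<le> (\<Sum>k\<in>{K<..L}. recip_klog k)"
    using assms(2)
  proof (induction L rule: dec_induct)
    case (step L)
    have "{K<..Suc L} = insert (Suc L) {K<..L}" using step by auto
    then have "(\<Sum>k\<in>{K<..Suc L}. recip_klog k) = recip_klog (Suc L) + (\<Sum>k\<in>{K<..L}. recip_klog k)"
      by simp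
    moreover have "ln 2 * (ln (ln (real (Suc L) + 1)) - ln (ln (real (Suc L)))) \<le> recip_klog (Suc L)"
      unfolding eq using step assms(1) by (intro mult_left_mono up) auto
    ultimately show ?case using step.IH by (simp add: algebra_simps)
  qed simp
  show "(\<Sum>k\<in>{K<..L}. recip_klog k) \<le> ln 2 * (ln (ln (real L)) - ln (ln (real K)))"
    using assms(2)
  proof (induction L rule: dec_induct)
    case (step L)
    have "{K<..Suc L} = insert (Suc L) {K<..L}" using step by auto
    then have "(\<Sum>k\<in>{K<..Suc L}. recip_klog k) = recip_klog (Suc L) + (\<Sum>k\<in>{K<..L}. recip_klog k)"
      by simp
    moreover have "recip_klog (Suc L) \<le> ln 2 * (ln (ln (real (Suc L))) - ln (ln (real L)))"
      unfolding eq using step assms(1) by (intro mult_left_mono dn) auto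
    ultimately show ?case using step.IH by (simp add: algebra_simps)
  qed simp
qed

lemma lnln_mono: "1 < x \<Longrightarrow> x \<le> y \<Longrightarrow> ln (ln x) \<le> ln (ln y)" for x y :: real
  by simp

text \<open>The constant in \<open>\<sigma>\<^sup>2\<close>: the doubly logarithmic primitive is evaluated between
  \<open>sqrt (log n)\<close> and \<open>log n\<close> up to constant factors, and \<open>log (log n) - log (sqrt (log n))\<close>
  is half of \<open>log (log n)\<close>.\<close>

lemma klog_sum_tendsto: "klog_sum \<longlonglongrightarrow> (ln 2)\<^sup>2"
proof (rule tendsto_sandwich)
  \<comment> \<open>In this form \<open>1 / 2\<close> is the exponent in
    \<open>sqrt (log 2 (2 * n))\<close>; the divisor 4 and the shifts by 1 disappear under
    \<open>ln ln\<close>.\<close>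
  have e: "(ln 2)\<^sup>2 = - (ln 2 * ln (1 / 2 :: real))" by (simp add: ln_div power2_eq_square)
  have ev: "\<forall>\<^sub>F n in sequentially. 3 \<le> lo n \<and> lo n + 3 \<le> hi n \<and> 1 \<le> n
      \<and> 3 < sqrt (log 2 (2 * real n)) \<and> 1 < log 2 (real n) / 4"
  proof (intro eventually_conj)
    show "\<forall>\<^sub>F n in sequentially. 3 \<le> lo n" using lo_at_top by (simp add: filterlim_at_top)
    show "\<forall>\<^sub>F n in sequentially. lo n + 3 \<le> hi n" by (rule lo_hi)
  qed (simp add: eventually_ge_at_top, real_asymp+)
  show "\<forall>\<^sub>F n in sequentially. ln 2 * (ln (ln (log 2 (real n) / 4)) - ln (ln (sqrt (log 2 (2 * real n)) + 1))) \<le> klog_sum n"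
    using ev
  proof eventually_elim
    case (elim n)
    have "ln (ln (log 2 (real n) / 4)) \<le> ln (ln (real (hi n) + 1))"
      using elim hi_bounds[of n] by (intro lnln_mono) auto
    moreover have "ln (ln (real (lo n) + 1)) \<le> ln (ln (sqrt (log 2 (2 * real n)) + 1))"
      using elim lo_bounds[of n] by (intro lnln_mono) auto
    ultimately have "ln 2 * (ln (ln (log 2 (real n) / 4)) - ln (ln (sqrt (log 2 (2 * real n)) + 1)))
       \<le> ln 2 * (ln (ln (real (hi n) + 1)) - ln (ln (real (lo n) + 1)))"
      by (intro mult_left_mono) auto
    also have "\<dots> \<le> klog_sum n"
      unfolding klog_sum_def using elim by (intro klog_sum_telescope) auto
    finally show ?case .
  qed
  show "\<forall>\<^sub>F n in sequentially. klog_sum n \<le> ln 2 * (ln (ln (log 2 (real n) / 4)) - ln (ln (sqrt (log 2 (2 * real n)) - 1)))"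
    using ev
  proof eventually_elim
    case (elim n)
    have "klog_sum n \<le> ln 2 * (ln (ln (real (hi n))) - ln (ln (real (lo n))))"
      unfolding klog_sum_def using elim by (intro klog_sum_telescope) auto
    also have "\<dots> \<le> ln 2 * (ln (ln (log 2 (real n) / 4)) - ln (ln (sqrt (log 2 (2 * real n)) - 1)))"
    proof (intro mult_left_mono diff_mono lnln_mono)
      show "real (hi n) \<le> log 2 (real n) / 4" using elim hi_bounds by auto
      show "sqrt (log 2 (2 * real n)) - 1 \<le> real (lo n)" using elim lo_bounds[of n] by simp
    qed (use elim in auto)
    finally show ?case .
  qed
  show "(\<lambda>n. ln 2 * (ln (ln (log 2 (real n) / 4)) - ln (ln (sqrt (log 2 (2 * real n)) + 1)))) \<longlonglongrightarrow> (ln 2)\<^sup>2"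
    unfolding e by real_asymp
  show "(\<lambda>n. ln 2 * (ln (ln (log 2 (real n) / 4)) - ln (ln (sqrt (log 2 (2 * real n)) - 1)))) \<longlonglongrightarrow> (ln 2)\<^sup>2"
    unfolding e by real_asymp
qed

text \<open>The square stands for the two copies in \<open>f_k\<close>, one of them delayed by
  \<open>d_seq k\<close>; \<open>char_birkhoff_block\<close> gives the probabilistic
  meaning.\<close>

definition block_factor :: "nat \<Rightarrow> nat \<Rightarrow> real \<Rightarrow> real" where
  "block_factor n k t = (block_char ((alpha_seq k)\<^sup>2) (p_seq k) n t)\<^sup>2"

lemma block_factor_bounds: "k \<ge> 2 \<Longrightarrow> 0 \<le> block_factor n k t \<and> block_factor n k t \<le> 1"
  using block_char_bounds[OF alpha_sq_bounds, of k "p_seq k" n t]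
  by (simp add: block_factor_def power_le_one)

lemma prod_block_factor_bounds:
  assumes "A \<subseteq> {2..}"
  shows "0 \<le> (\<Prod>k\<in>A. block_factor n k t)" "(\<Prod>k\<in>A. block_factor n k t) \<le> 1"
proof -
  have "0 \<le> block_factor n k t \<and> block_factor n k t \<le> 1" if "k \<in> A" for k
    using that assms by (intro block_factor_bounds) auto
  then show "0 \<le> (\<Prod>k\<in>A. block_factor n k t)" "(\<Prod>k\<in>A. block_factor n k t) \<le> 1"
    by (auto intro: prod_nonneg prod_le_1)
qed

lemma block_factor_le:
  fixes t :: real
  assumes "k \<ge> 2" "p_seq k \<le> n"
  shows "block_factor n k t \<le> exp (- (2 * (real n - p_seq k) * ((alpha_seq k)\<^sup>2 * (1 - cos (t * p_seq k)))))"
proof -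
  have "block_factor n k t \<le> (exp (- ((real n - p_seq k) * ((alpha_seq k)\<^sup>2 * (1 - cos (t * p_seq k))))))\<^sup>2"
    unfolding block_factor_def
    by (intro power_mono block_char_le block_char_bounds alpha_sq_bounds assms)
  then show ?thesis by (simp only: exp_double[symmetric] mult_minus_right mult.assoc)
qed

text \<open>Here \<open>alpha_k^2 * t^2 * p_k^2 <= t^2\<close>, so the relative error from
  \<open>block_char_ge\<close> is at most \<open>t^2\<close> uniformly in \<open>k\<close>. Squaring
  removes the \<open>1 / 2\<close> in the exponent.\<close>

lemma block_factor_ge:
  fixes t :: real
  assumes "k \<ge> 2" "t\<^sup>2 \<le> 1"
  shows "block_factor n k t \<ge> exp (- ((1 + t\<^sup>2) * (n * t\<^sup>2) * recip_klog k))"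
proof -
  define a where "a = (alpha_seq k)\<^sup>2"
  define b where "b = recip_klog k"
  have ab: "a * (real (p_seq k))\<^sup>2 = b" unfolding a_def b_def by (rule alpha_sq_p_sq[OF assms(1)])
  have b: "0 < b" "b \<le> 1/2" using recip_klog_pos recip_klog_le assms by (auto simp: b_def)
  have e: "a * t\<^sup>2 * (real (p_seq k))\<^sup>2 = b * t\<^sup>2" using ab by (metis mult.commute mult.left_commute)
  have bt: "b * t\<^sup>2 \<le> 1 * t\<^sup>2" using b by (intro mult_right_mono) auto
  have 1: "exp (- ((1 + b * t\<^sup>2) * (b * t\<^sup>2 / 2 * n))) \<le> block_char a (p_seq k) n t"
    using block_char_ge[OF alpha_sq_bounds[OF assms(1)], of t "p_seq k" n] bt assms(2)
    unfolding a_def[symmetric] e ab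
    by (simp add: mult.assoc mult.left_commute[of _ n] flip: ab e) (simp add: mult_ac)
  have "(1 + b * t\<^sup>2) * (b * t\<^sup>2 / 2 * n) \<le> (1 + t\<^sup>2) * (b * t\<^sup>2 / 2 * n)"
    using b bt by (intro mult_right_mono) auto
  with 1 have "exp (- ((1 + t\<^sup>2) * (b * t\<^sup>2 / 2 * n))) \<le> block_char a (p_seq k) n t"
    by (intro order_trans[OF _ 1]) simp
  then have "(exp (- ((1 + t\<^sup>2) * (b * t\<^sup>2 / 2 * n))))\<^sup>2 \<le> block_factor n k t"
    unfolding block_factor_def a_def by (intro power_mono) auto
  then show ?thesis by (simp add: exp_double[symmetric] b_def mult_ac)
qed

text \<open>From \<open>1 - c^2 <= 2 * (1 - c)\<close>. The factor \<open>min 1 (n / p)\<close>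
  reflects that no overlap exceeds \<open>n\<close>; it makes the blocks with \<open>p_seq k\<close>
  far above \<open>n\<close> summable.\<close>

lemma one_minus_block_factor_le:
  fixes t :: real
  assumes "k \<ge> 2"
  shows "1 - block_factor n k t \<le> (n * t\<^sup>2) * (recip_klog k * min 1 (real n / p_seq k))"
proof -
  define a where "a = (alpha_seq k)\<^sup>2"
  define c where "c = block_char a (p_seq k) n t"
  have p: "real (p_seq k) > 0" using p_seq_pos by simp
  have c: "0 \<le> c" "c \<le> 1" "1 - c \<le> a * t\<^sup>2 / 2 * min (p_seq k) n * n * p_seq k"
    unfolding c_def a_def
    by (intro block_char_bounds one_minus_block_char_le alpha_sq_bounds assms)+
  have "1 - c\<^sup>2 = (1 - c) * (1 + c)" by (simp add: power2_eq_square algebra_simps)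
  also have "\<dots> \<le> (1 - c) * 2" using c by (intro mult_left_mono) auto
  also have "\<dots> \<le> (a * t\<^sup>2 / 2 * min (p_seq k) n * n * p_seq k) * 2"
    using c by (intro mult_right_mono) auto
  also have "\<dots> = (n * t\<^sup>2) * (a * (real (p_seq k) * real (p_seq k)) * (min (p_seq k) n / p_seq k))"
    using p by simp
  also have "a * (real (p_seq k) * real (p_seq k)) = recip_klog k"
    using alpha_sq_p_sq[OF assms] by (simp add: a_def power2_eq_square)
  also have "real (min (p_seq k) n) / p_seq k = min 1 (real n / p_seq k)"
    using p by (auto simp: min_def divide_simps)
  finally show ?thesis unfolding c_def a_def block_factor_def .
qed

section \<open>The main product and its Gaussian limit\<close>

definition main_prod :: "nat \<Rightarrow> real \<Rightarrow> real" where
  "main_prod n t = (\<Prod>k\<in>{lo n<..hi n}. block_factor n k t)"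

lemma main_prod_ge:
  fixes t :: real
  assumes "1 \<le> lo n" "t\<^sup>2 \<le> 1"
  shows "main_prod n t \<ge> exp (- ((1 + t\<^sup>2) * (n * t\<^sup>2) * klog_sum n))"
proof -
  have "exp (- ((1 + t\<^sup>2) * (n * t\<^sup>2) * klog_sum n))
      = (\<Prod>k\<in>{lo n<..hi n}. exp (- ((1 + t\<^sup>2) * (n * t\<^sup>2) * recip_klog k)))"
    by (simp add: klog_sum_def exp_sum[symmetric] sum_distrib_left sum_negf)
  also have "\<dots> \<le> main_prod n t"
    unfolding main_prod_def using assms by (intro prod_mono conjI block_factor_ge) auto
  finally show ?thesis .
qed

text \<open>Two losses against the ideal exponent, both from \<open>p <= n^(1/4)\<close>: the
  boundary indices cost \<open>n - p >= n * (1 - n^(-3/4))\<close>, and the quartic term of the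
  cosine costs at most \<open>t^2 * n^(1/2) / 12\<close>, which the hypothesis keeps below
  1.\<close>

lemma main_prod_le:
  fixes t :: real
  assumes "1 \<le> n" "1 \<le> lo n" "t\<^sup>2 * real n powr (1/2) \<le> 12"
  shows "main_prod n t \<le> exp (- ((1 - real n powr (-3/4)) * (1 - t\<^sup>2 * real n powr (1/2) / 12)
            * (n * t\<^sup>2) * klog_sum n))"
proof -
  define \<eta> where "\<eta> = real n powr (-3/4)"
  define \<zeta> where "\<zeta> = t\<^sup>2 * real n powr (1/2) / 12"
  have \<zeta>: "0 \<le> \<zeta>" "\<zeta> \<le> 1" using assms(3) by (auto simp: \<zeta>_def)
  have n\<eta>: "n * \<eta> = real n powr (1/4)"
  proof -
    have "n * \<eta> = real n powr 1 * real n powr (-3/4)" using assms by (simp add: \<eta>_def)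
    also have "\<dots> = real n powr (1/4)" by (subst powr_add[symmetric]) simp
    finally show ?thesis .
  qed
  have \<eta>: "\<eta> \<le> 1"
  proof -
    have "\<eta> \<le> real n powr 0" unfolding \<eta>_def using assms by (intro powr_mono) auto
    then show ?thesis using assms by simp
  qed
  have "block_factor n k t \<le> exp (- ((1 - \<eta>) * (1 - \<zeta>) * (n * t\<^sup>2) * recip_klog k))"
    if k: "k \<in> {lo n<..hi n}" for k
  proof -
    have k2: "k \<ge> 2" using k assms by auto
    have p: "real (p_seq k) \<le> real n powr (1/4)" using k assms by (intro p_seq_le_hi) auto
    also have "\<dots> \<le> real n powr 1" using assms by (intro powr_mono) auto
    finally have pn: "p_seq k \<le> n" by simp
    have "(real (p_seq k))\<^sup>2 \<le> (real n powr (1/4))\<^sup>2" using p by (intro power_mono) auto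
    also have "\<dots> = real n powr (1/2)" using assms by (simp add: powr_power)
    finally have "t\<^sup>2 * (real (p_seq k))\<^sup>2 / 12 \<le> \<zeta>"
      unfolding \<zeta>_def by (intro divide_right_mono mult_left_mono) auto
    then have tp: "1 - \<zeta> \<le> 1 - (t * p_seq k)\<^sup>2 / 12" by (simp add: power_mult_distrib)
    have "(1 - \<eta>) * (1 - \<zeta>) * (n * t\<^sup>2) * recip_klog k
        = 2 * (n * (1 - \<eta>)) * ((alpha_seq k)\<^sup>2 * ((t * p_seq k)\<^sup>2 / 2 * (1 - \<zeta>)))"
      by (simp add: alpha_sq_p_sq[OF k2, symmetric] power_mult_distrib)
    also have "\<dots> \<le> 2 * (real n - p_seq k) * ((alpha_seq k)\<^sup>2 * (1 - cos (t * p_seq k)))"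
    proof (intro mult_mono)
      show "n * (1 - \<eta>) \<le> real n - p_seq k" using p n\<eta> by (simp add: algebra_simps)
      have "(t * p_seq k)\<^sup>2 / 2 * (1 - \<zeta>) \<le> (t * p_seq k)\<^sup>2 / 2 * (1 - (t * p_seq k)\<^sup>2 / 12)"
        using tp by (intro mult_left_mono) auto
      also have "\<dots> \<le> 1 - cos (t * p_seq k)" by (rule one_minus_cos_ge)
      finally show "(t * p_seq k)\<^sup>2 / 2 * (1 - \<zeta>) \<le> 1 - cos (t * p_seq k)" .
    qed (use pn \<zeta> \<eta> in auto)
    finally show ?thesis
      by (intro order_trans[OF block_factor_le[OF k2 pn]]) simp
  qed
  then have "main_prod n t \<le> (\<Prod>k\<in>{lo n<..hi n}. exp (- ((1 - \<eta>) * (1 - \<zeta>) * (n * t\<^sup>2) * recip_klog k)))"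
    unfolding main_prod_def using assms block_factor_bounds by (intro prod_mono) auto
  also have "\<dots> = exp (- ((1 - \<eta>) * (1 - \<zeta>) * (n * t\<^sup>2) * klog_sum n))"
    by (simp add: klog_sum_def exp_sum[symmetric] sum_distrib_left sum_negf)
  finally show ?thesis unfolding \<eta>_def \<zeta>_def .
qed

lemma main_prod_tendsto:
  "(\<lambda>n. main_prod n (s / sqrt n)) \<longlonglongrightarrow> exp (- (sigma_sq * s\<^sup>2 / 2))"
proof (rule tendsto_sandwich)
  have lo1: "\<forall>\<^sub>F n in sequentially. 1 \<le> lo n" using lo_at_top by (simp add: filterlim_at_top)
  have n1: "\<forall>\<^sub>F n in sequentially. 1 \<le> (n::nat)" by (rule eventually_ge_at_top)
  have "(\<lambda>n. s\<^sup>2 / real n) \<longlonglongrightarrow> 0" by real_asymp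
  then have "\<forall>\<^sub>F n in sequentially. s\<^sup>2 / real n < 1" by (rule order_tendstoD) simp
  with lo1 n1 show "\<forall>\<^sub>F n in sequentially. exp (- ((1 + s\<^sup>2 / n) * s\<^sup>2 * klog_sum n)) \<le> main_prod n (s / sqrt n)"
  proof eventually_elim
    case (elim n)
    then show ?case using main_prod_ge[of n "s / sqrt n"] by (simp add: power_divide)
  qed
  have "(\<lambda>n. s\<^sup>2 / real n * real n powr (1/2)) \<longlonglongrightarrow> 0" by real_asymp
  then have "\<forall>\<^sub>F n in sequentially. s\<^sup>2 / real n * real n powr (1/2) < 12" by (rule order_tendstoD) simp
  with lo1 n1 show "\<forall>\<^sub>F n in sequentially. main_prod n (s / sqrt n) \<le>
     exp (- ((1 - real n powr (-3/4)) * (1 - s\<^sup>2 / real n * real n powr (1/2) / 12) * s\<^sup>2 * klog_sum n))"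
  proof eventually_elim
    case (elim n)
    then show ?case using main_prod_le[of n "s / sqrt n"] by (simp add: power_divide)
  qed
  have e: "sigma_sq * s\<^sup>2 / 2 = (1 + 0) * s\<^sup>2 * (ln 2)\<^sup>2" "sigma_sq * s\<^sup>2 / 2 = 1 * 1 * s\<^sup>2 * (ln 2)\<^sup>2"
    by (simp_all add: sigma_sq_def)
  have "(\<lambda>n. s\<^sup>2 / real n) \<longlonglongrightarrow> 0" by real_asymp
  then show "(\<lambda>n. exp (- ((1 + s\<^sup>2 / n) * s\<^sup>2 * klog_sum n))) \<longlonglongrightarrow> exp (- (sigma_sq * s\<^sup>2 / 2))"
    unfolding e(1) by (intro tendsto_intros klog_sum_tendsto)
  have "(\<lambda>n. 1 - real n powr (-3/4)) \<longlonglongrightarrow> 1" by real_asymp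
  moreover have "(\<lambda>n. 1 - s\<^sup>2 / real n * real n powr (1/2) / 12) \<longlonglongrightarrow> 1" by real_asymp
  ultimately show "(\<lambda>n. exp (- ((1 - real n powr (-3/4)) * (1 - s\<^sup>2 / real n * real n powr (1/2) / 12) * s\<^sup>2 * klog_sum n)))
     \<longlonglongrightarrow> exp (- (sigma_sq * s\<^sup>2 / 2))"
    unfolding e(2) by (intro tendsto_intros klog_sum_tendsto)
qed

section \<open>Error terms: the high blocks and the coboundaries\<close>

lemma tail_prod_bound:
  fixes t :: real
  assumes "2 \<le> hi n" "1 \<le> n"
  shows "1 - (\<Prod>k\<in>{hi n<..N}. block_factor n k t)
      \<le> (n * t\<^sup>2) * (recip_klog (hi n) * (3 * real (hi n) + 6))"
proof -
  define L where "L = hi n"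
  \<comment> \<open>Chosen so that \<open>n <= 2^H\<close>. Above \<open>H\<close> the ratio
    \<open>n / p_seq k\<close> decays geometrically with sum at most 2; the \<open>3 * L + 4\<close>
    blocks up to \<open>H\<close> are simply counted.\<close>
  define H where "H = 4 * L + 4"
  have nH: "real n \<le> 2 ^ H"
  proof -
    have "log 2 (real n) \<le> real H" using hi_bounds(2)[of n] assms by (simp add: H_def L_def)
    then have "real n \<le> 2 powr (real H)" using assms by (subst (asm) log_le_iff) auto
    then show ?thesis by (simp add: powr_realpow)
  qed
  define g :: "nat \<Rightarrow> real" where "g k = (if k \<le> H then 1 else 2 * (1/2) ^ (k - H))" for k
  have g0: "g k \<ge> 0" for k by (simp add: g_def)
  have term_le: "min 1 (real n / p_seq k) \<le> g k" for k
  proof (cases "k \<le> H")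
    case False
    have p: "(2::real) ^ k \<le> 2 * real (p_seq k)" using of_nat_mono[OF p_seq_ge[of k], where ?'a=real] by simp
    have "real n / p_seq k \<le> 2 ^ H / (2 ^ k / 2)"
      using nH p p_seq_pos[of k] by (intro frac_le) auto
    also have "\<dots> = g k"
      using False by (simp add: g_def power_one_over power_diff)
    finally show ?thesis by simp
  qed (simp add: g_def)
  have geo: "(\<Sum>k\<in>{H<..N'}. 2 * (1/2::real) ^ (k - H)) \<le> 2" for N'
  proof -
    have "(\<Sum>k\<in>{H<..H+j}. 2 * (1/2::real) ^ (k - H)) = 2 - 2 * (1/2) ^ j" for j
    proof (induction j)
      case (Suc j)
      have "{H<..H + Suc j} = insert (H + Suc j) {H<..H+j}" by auto
      then show ?case using Suc by simp
    qed simp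
    from this[of "N' - H"] show ?thesis by (cases "H \<le> N'") auto
  qed
  have "(\<Sum>k\<in>{L<..N}. g k) \<le> (\<Sum>k\<in>{L<..H} \<union> {H<..N}. g k)"
    using g0 by (intro sum_mono2) auto
  also have "\<dots> \<le> (\<Sum>k\<in>{L<..H}. g k) + (\<Sum>k\<in>{H<..N}. g k)"
    by (subst sum.union_disjoint) auto
  also have "(\<Sum>k\<in>{L<..H}. g k) = real (3 * L + 4)" by (simp add: g_def H_def)
  also have "(\<Sum>k\<in>{H<..N}. g k) \<le> 2" using geo[of N] by (simp add: g_def)
  finally have sum_g: "(\<Sum>k\<in>{L<..N}. g k) \<le> 3 * real L + 6" by simp
  have "1 - (\<Prod>k\<in>{L<..N}. 1 - (1 - block_factor n k t)) \<le> (\<Sum>k\<in>{L<..N}. 1 - block_factor n k t)"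
  proof -
    have "1 - (\<Sum>k\<in>{L<..N}. 1 - block_factor n k t) \<le> (\<Prod>k\<in>{L<..N}. 1 - (1 - block_factor n k t))"
      using block_factor_bounds assms by (intro Weierstrass_prod_ineq) (auto simp: L_def)
    then show ?thesis by simp
  qed
  also have "\<dots> \<le> (\<Sum>k\<in>{L<..N}. (n * t\<^sup>2) * (recip_klog L * g k))"
  proof (rule sum_mono)
    fix k assume k: "k \<in> {L<..N}"
    have "1 - block_factor n k t \<le> (n * t\<^sup>2) * (recip_klog k * min 1 (real n / p_seq k))"
      using k assms by (intro one_minus_block_factor_le) (auto simp: L_def)
    also have "\<dots> \<le> (n * t\<^sup>2) * (recip_klog L * g k)"
      using k assms recip_klog_pos[of L] by (intro mult_left_mono mult_mono recip_klog_antimono term_le) (auto simp: L_def)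
    finally show "1 - block_factor n k t \<le> (n * t\<^sup>2) * (recip_klog L * g k)" .
  qed
  also have "\<dots> = (n * t\<^sup>2) * (recip_klog L * (\<Sum>k\<in>{L<..N}. g k))"
    by (simp add: sum_distrib_left)
  also have "\<dots> \<le> (n * t\<^sup>2) * (recip_klog L * (3 * real L + 6))"
    using sum_g recip_klog_pos[of L] assms by (intro mult_left_mono) (auto simp: L_def)
  finally show ?thesis by (simp add: L_def)
qed

text \<open>The number of blocks cancels the factor \<open>k\<close> of
  \<open>1 / (k * log k)\<close>; what remains is about \<open>3 / log (hi n)\<close>, so the
  logarithm in \<open>alpha_seq\<close> is what makes the tail vanish.\<close>

lemma tail_bound_tendsto: "(\<lambda>n. recip_klog (hi n) * (3 * real (hi n) + 6)) \<longlonglongrightarrow> 0"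
proof -
  have "(\<lambda>L. recip_klog L * (3 * real L + 6)) \<longlonglongrightarrow> 0"
    unfolding recip_klog_def by real_asymp
  then show ?thesis by (rule filterlim_compose[OF _ hi_at_top])
qed

text \<open>\<open>recip_klog k * d_seq k\<close> is the variance scale of the transfer function
  \<open>orbit_sum k (d_seq k)\<close>, here measured against \<open>n\<close>.\<close>

definition coboundary_bound :: "nat \<Rightarrow> real" where
  "coboundary_bound n = (\<Sum>k\<in>{2..lo n}. sqrt (recip_klog k * d_seq k / n))"

text \<open>The top block \<open>K = lo n\<close> is critical: \<open>d_seq K\<close> may be
  comparable to \<open>2 * n\<close>, and its term is small only through
  \<open>recip_klog K\<close>. Each lower block gains \<open>K^2 - k^2 >= 2 * K - 1\<close> in the
  exponent of 2, which beats the number of blocks.\<close>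

lemma coboundary_bound_tendsto: "coboundary_bound \<longlonglongrightarrow> 0"
proof (rule tendsto_sandwich)
  show "\<forall>\<^sub>F n in sequentially. 0 \<le> coboundary_bound n"
    unfolding coboundary_bound_def using recip_klog_pos
    by (intro always_eventually allI sum_nonneg) (auto simp: less_imp_le)
  have "\<forall>\<^sub>F n in sequentially. 2 \<le> lo n" using lo_at_top by (simp add: filterlim_at_top)
  with eventually_ge_at_top[of 1]
  show "\<forall>\<^sub>F n in sequentially. coboundary_bound n \<le> sqrt (2 * recip_klog (lo n)) + lo n * (2 / 2 ^ lo n)"
  proof eventually_elim
    case (elim n)
    define K where "K = lo n"
    have dK: "real (d_seq K) \<le> 2 * real n" using elim by (intro d_seq_le_lo) (auto simp: K_def)
    have term_le: "sqrt (recip_klog k * d_seq k / n) \<le> 2 / 2 ^ K" if k: "k \<in> {2..<K}" for k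
    proof -
      have "k\<^sup>2 + 2 * K \<le> K\<^sup>2 + 1"
      proof -
        from k obtain j where "K = Suc j" "k \<le> j" by (cases K) auto
        moreover from this have "k\<^sup>2 \<le> j\<^sup>2" by (intro power_mono) auto
        ultimately show ?thesis by (simp add: power2_eq_square)
      qed
      then have "2 ^ (k\<^sup>2 + 2 * K) \<le> (2::real) ^ (K\<^sup>2 + 1)" by (intro power_increasing) auto
      then have "real (d_seq k) * (2 ^ K)\<^sup>2 \<le> 2 * real (d_seq K)"
        by (simp add: d_seq_def power_add power_mult mult.commute[of K] flip: power_mult)
      then have d: "real (d_seq k) \<le> 4 * n / (2 ^ K)\<^sup>2" using dK by (simp add: pos_le_divide_eq)
      have "recip_klog k * real (d_seq k) \<le> 1 * (4 * n / (2 ^ K)\<^sup>2)"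
        using recip_klog_le[of k] k by (intro mult_mono d) auto
      then have "recip_klog k * real (d_seq k) / n \<le> (2 / 2 ^ K)\<^sup>2"
        using elim by (simp add: field_simps)
      then have "sqrt (recip_klog k * d_seq k / n) \<le> sqrt ((2 / 2 ^ K)\<^sup>2)" by (rule real_sqrt_le_mono)
      then show ?thesis by simp
    qed
    have "coboundary_bound n = sqrt (recip_klog K * d_seq K / n) + (\<Sum>k\<in>{2..<K}. sqrt (recip_klog k * d_seq k / n))"
    proof -
      have "{2..K} = insert K {2..<K}" using elim by (auto simp: K_def)
      then show ?thesis by (simp add: coboundary_bound_def K_def[symmetric])
    qed
    also have "\<dots> \<le> sqrt (2 * recip_klog K) + (\<Sum>k\<in>{2..<K}. 2 / 2 ^ K)"
    proof (intro add_mono sum_mono term_le real_sqrt_le_mono)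
      have "recip_klog K * d_seq K \<le> recip_klog K * (2 * n)"
        using dK recip_klog_pos[of K] elim by (intro mult_left_mono) (auto simp: K_def)
      then show "recip_klog K * d_seq K / n \<le> 2 * recip_klog K" using elim by (simp add: field_simps)
    qed
    also have "(\<Sum>k\<in>{2..<K}. 2 / 2 ^ K) \<le> real K * (2 / 2 ^ K)"
      by (simp add: divide_right_mono mult_right_mono)
    finally show ?case by (simp add: K_def)
  qed
  have "(\<lambda>K. sqrt (2 * recip_klog K) + real K * (2 / 2 ^ K)) \<longlonglongrightarrow> 0"
    unfolding recip_klog_def by real_asymp
  then show "(\<lambda>n. sqrt (2 * recip_klog (lo n)) + lo n * (2 / 2 ^ lo n)) \<longlonglongrightarrow> 0"
    by (rule filterlim_compose[OF _ lo_at_top])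
qed simp

section \<open>Decay of the main product on the period interval\<close>

lemma main_prod_le_pair:
  assumes "1 \<le> lo n" "lo n < k" "k < hi n"
  shows "main_prod n t \<le> block_factor n k t * block_factor n (Suc k) t"
proof -
  have "{lo n<..hi n} = {k, Suc k} \<union> ({lo n<..hi n} - {k, Suc k})" using assms by auto
  then have "main_prod n t = (\<Prod>j\<in>{k, Suc k}. block_factor n j t) * (\<Prod>j\<in>{lo n<..hi n} - {k, Suc k}. block_factor n j t)"
    unfolding main_prod_def by (metis Diff_disjoint finite.emptyI finite_insert finite_Diff finite_greaterThanAtMost prod.union_disjoint)
  also have "\<dots> \<le> (\<Prod>j\<in>{k, Suc k}. block_factor n j t) * 1"
    using assms block_factor_bounds by (intro mult_left_mono prod_le_1 prod_nonneg) auto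
  finally show ?thesis by simp
qed

text \<open>The parity in the definition of \<open>p\<close> is used here: \<open>p\<close> and \<open>p + 1\<close> cannot both
  bring \<open>t\<close> close to a multiple of \<open>2 \<pi>\<close>.\<close>

lemma cos_consecutive:
  fixes t q :: real
  shows "(1 - cos t) / 2 \<le> (1 - cos (t * q)) + (1 - cos (t * (q + 1)))"
proof -
  \<comment> \<open>In half angles \<open>y - x = t / 2\<close>, so \<open>sin x\<close> and
    \<open>sin y\<close> cannot both be small against \<open>sin (t / 2)\<close>.\<close>
  define x y where "x = t * q / 2" and "y = t * (q + 1) / 2"
  have c: "1 - cos (2 * z) = 2 * (sin z)\<^sup>2" for z :: real by (simp add: cos_double_sin)
  have "\<bar>sin (y - x)\<bar> \<le> \<bar>sin y\<bar> * \<bar>cos x\<bar> + \<bar>cos y\<bar> * \<bar>sin x\<bar>"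
    unfolding sin_diff by (metis abs_mult abs_triangle_ineq4)
  also have "\<dots> \<le> \<bar>sin y\<bar> * 1 + 1 * \<bar>sin x\<bar>"
    by (intro add_mono mult_mono) auto
  finally have "(sin (y - x))\<^sup>2 \<le> (\<bar>sin y\<bar> + \<bar>sin x\<bar>)\<^sup>2"
    by (simp add: abs_le_square_iff[symmetric])
  also have "\<dots> \<le> 2 * ((sin x)\<^sup>2 + (sin y)\<^sup>2)"
    using sum_squares_bound[of "\<bar>sin y\<bar>" "\<bar>sin x\<bar>"] by (simp add: power2_sum)
  finally have "2 * (sin (y - x))\<^sup>2 / 2 \<le> 2 * (sin x)\<^sup>2 + 2 * (sin y)\<^sup>2" by simp
  moreover have "2 * (y - x) = t" "2 * x = t * q" "2 * y = t * (q + 1)"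
    by (simp_all add: x_def y_def field_simps)
  ultimately show ?thesis
    unfolding c[symmetric] by (simp only:)
qed

text \<open>Crude, but for \<open>k\<close> of order \<open>sqrt (log n)\<close> the number
  \<open>16^k\<close> is still below every positive power of \<open>n\<close>, up to
  constants.\<close>

lemma alpha_sq_ge: "1 / 16 ^ k \<le> (alpha_seq k)\<^sup>2" if "k \<ge> 2"
proof -
  have k: "real k \<le> 2 ^ k" using of_nat_mono[OF less_imp_le[OF less_exp[of k]], where ?'a=real] by simp
  then have l: "log 2 (real k) \<le> real k" using that by (subst log_le_iff) (auto simp: powr_realpow)
  have "real k * log 2 (real k) \<le> 2 ^ k * 2 ^ k"
    using order_trans[OF l k] k log2_ge_1[OF that] by (intro mult_mono) auto
  moreover have "(real (p_seq k))\<^sup>2 \<le> (2 ^ k)\<^sup>2"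
    using of_nat_mono[OF p_seq_le[of k], where ?'a=real] that by (intro power_mono) auto
  ultimately have "(real k * log 2 (real k)) * (real (p_seq k))\<^sup>2 \<le> (2 ^ k * 2 ^ k) * (2 ^ k)\<^sup>2"
    by (rule mult_mono) auto
  also have "(2 ^ k * 2 ^ k) * (2 ^ k)\<^sup>2 = (16::real) ^ k"
    by (simp add: power2_eq_square power_mult_distrib[symmetric])
  finally show ?thesis
    using log2_ge_1[OF that] p_seq_pos[of k] that
    by (simp add: alpha_sq recip_klog_def frac_le)
qed

lemma main_prod_decay_small:
  fixes t :: real
  assumes n: "1 \<le> n" "1 \<le> lo n" "real n powr (-3/4) \<le> 1 / 2"
    and t: "t\<^sup>2 * real n powr (1/2) \<le> 1" and B: "(ln 2)\<^sup>2 / 2 \<le> klog_sum n"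
  shows "main_prod n t \<le> 64 / (1 + n * t\<^sup>2)"
proof -
  \<comment> \<open>A factor \<open>1 / 2\<close> for each of the two losses in
    \<open>main_prod_le\<close>, times half the limit of \<open>klog_sum\<close>. With
    \<open>ln 2 >= 1 / 2\<close> this gives \<open>c >= 1 / 32\<close>, for which 64 is a
    comfortable final constant.\<close>
  define c :: real where "c = (ln 2)\<^sup>2 / 8"
  have ln2: "(ln 2 :: real) \<ge> 1/2" using ln_le_minus_one[of "1 / 2"] by (simp add: ln_div)
  then have c: "1 / 32 \<le> c" "0 < c" 
    using power_mono[of "1/2" "ln 2 :: real" 2] by (auto simp: c_def power2_eq_square)
  have "main_prod n t \<le> exp (- ((1 - real n powr (-3/4)) * (1 - t\<^sup>2 * real n powr (1/2) / 12)
            * (n * t\<^sup>2) * klog_sum n))"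
    using n t by (intro main_prod_le) auto
  also have "\<dots> \<le> exp (- (c * (n * t\<^sup>2)))"
  proof -
    have "c * (n * t\<^sup>2) = (1/2) * (1/2) * (n * t\<^sup>2) * ((ln 2)\<^sup>2 / 2)" by (simp add: c_def)
    also have "\<dots> \<le> (1 - real n powr (-3/4)) * (1 - t\<^sup>2 * real n powr (1/2) / 12) * (n * t\<^sup>2) * klog_sum n"
      using n t B by (intro mult_mono) auto
    finally show ?thesis by simp
  qed
  also have "\<dots> = 1 / exp (c * (n * t\<^sup>2))" by (simp add: exp_minus inverse_eq_divide)
  also have "\<dots> \<le> 1 / (1 + c * (n * t\<^sup>2))"
    using exp_ge_add_one_self[of "c * (n * t\<^sup>2)"] c by (intro divide_left_mono) (auto intro!: mult_pos_pos add_pos_nonneg)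
  also have "\<dots> \<le> 1 / ((1 + n * t\<^sup>2) / 64)"
  proof (intro divide_left_mono)
    have "1 / 32 * (n * t\<^sup>2) \<le> c * (n * t\<^sup>2)" using c by (intro mult_right_mono) auto
    moreover have "0 \<le> real n * t\<^sup>2" by simp
    moreover have "(1 + z) / 64 \<le> 1 + w" if "1 / 32 * z \<le> w" "0 \<le> z" for z w :: real
      using that by (simp add: field_simps)
    ultimately show "(1 + n * t\<^sup>2) / 64 \<le> 1 + c * (n * t\<^sup>2)" by blast
  qed (use c in \<open>auto intro!: mult_pos_pos add_pos_nonneg\<close>)
  finally show ?thesis by simp
qed

lemma main_prod_decay_large:
  fixes t :: real
  assumes n: "1 \<le> n" "1 \<le> lo n" "lo n + 3 \<le> hi n" "real n powr (1/4) \<le> n / 2"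
    and t: "real n powr (-1/4) \<le> \<bar>t\<bar>" "\<bar>t\<bar> \<le> pi"
  shows "main_prod n t \<le> exp (- (real n powr (1/2) / 8 / 2 powr (4 * sqrt (log 2 (2 * real n)) + 12)))"
proof -
  \<comment> \<open>The first even index above \<open>lo n\<close>: from \<open>k\<close> to
    \<open>Suc k\<close> the value of \<open>p_seq\<close> grows by exactly 1, and both indices stay
    within the main range.\<close>
  define k where "k = (if even (lo n) then lo n + 2 else lo n + 1)"
  have k: "even k" "lo n < k" "Suc k \<le> lo n + 3" "2 \<le> k" using n(2) by (auto simp: k_def)
  have p: "real (p_seq j) \<le> n / 2" if "j \<in> {k, Suc k}" for j
    using p_seq_le_hi[of n j] that k n by auto
  define a where "a = (alpha_seq (Suc k))\<^sup>2"
  have a_le: "a \<le> (alpha_seq k)\<^sup>2"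
  proof -
    have "recip_klog (Suc k) / (real (p_seq (Suc k)))\<^sup>2 \<le> recip_klog k / (real (p_seq k))\<^sup>2"
      using k p_seq_pos[of k] recip_klog_pos[of k]
      by (intro frac_le recip_klog_antimono power_mono) (auto simp: p_seq_Suc)
    then show ?thesis using k by (simp add: a_def alpha_sq)
  qed
  have a_ge: "a \<ge> 1 / 2 powr (4 * sqrt (log 2 (2 * real n)) + 12)"
  proof -
    have "(16::real) ^ Suc k \<le> 16 ^ (lo n + 3)" using k by (intro power_increasing) auto
    also have "\<dots> = 2 powr (4 * real (lo n) + 12)"
    proof -
      have "(16::real) ^ (lo n + 3) = (2 ^ 4) ^ (lo n + 3)" by simp
      also have "\<dots> = 2 ^ (4 * (lo n + 3))" by (rule power_mult[symmetric])
      also have "\<dots> = 2 powr real (4 * (lo n + 3))" by (rule powr_realpow[symmetric]) simp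
      finally show ?thesis by simp
    qed
    also have "\<dots> \<le> 2 powr (4 * sqrt (log 2 (2 * real n)) + 12)"
      using lo_bounds(1)[OF n(1)] by simp
    finally have "1 / 2 powr (4 * sqrt (log 2 (2 * real n)) + 12) \<le> 1 / 16 ^ Suc k"
      by (intro divide_left_mono) auto
    also have "\<dots> \<le> a" unfolding a_def using k by (intro alpha_sq_ge) auto
    finally show ?thesis .
  qed
  have fac: "block_factor n j t \<le> exp (- (n * (a * (1 - cos (t * p_seq j)))))" if j: "j \<in> {k, Suc k}" for j
  proof -
    have "a \<le> (alpha_seq j)\<^sup>2" using a_le j by (auto simp: a_def)
    moreover have "real n \<le> 2 * (real n - p_seq j)" using p[OF j] by simp
    ultimately have "n * (a * (1 - cos (t * p_seq j)))
        \<le> 2 * (real n - p_seq j) * ((alpha_seq j)\<^sup>2 * (1 - cos (t * p_seq j)))"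
      by (intro mult_mono mult_right_mono) (auto simp: a_def)
    moreover have "real (p_seq j) \<le> real n" using p[OF j] by linarith
    then have "p_seq j \<le> n" by simp
    ultimately show ?thesis
      using j k by (intro order_trans[OF block_factor_le]) auto
  qed
  have "main_prod n t \<le> block_factor n k t * block_factor n (Suc k) t"
    using k n by (intro main_prod_le_pair) auto
  also have "\<dots> \<le> exp (- (n * (a * (1 - cos (t * p_seq k))))) * exp (- (n * (a * (1 - cos (t * p_seq (Suc k))))))"
    using k block_factor_bounds by (intro mult_mono fac) auto
  also have "\<dots> = exp (- (n * a * ((1 - cos (t * p_seq k)) + (1 - cos (t * (p_seq k + 1))))))"
    using k by (simp add: exp_add[symmetric] p_seq_Suc algebra_simps)
  also have "\<dots> \<le> exp (- (real n powr (1/2) / 8 / 2 powr (4 * sqrt (log 2 (2 * real n)) + 12)))"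
  proof -
    \<comment> \<open>The least admissible \<open>|t|\<close>. The cosine decreases on
      \<open>[0, pi]\<close>, so \<open>1 - cos t\<close> is at least its value at \<open>u\<close>,
      hence at least \<open>u^2 / 4\<close>; and \<open>n * u^2\<close> is
      \<open>sqrt n\<close>.\<close>
    define u where "u = real n powr (-1/4)"
    have u: "0 \<le> u" "u \<le> 1" "u\<^sup>2 = real n powr (-1/2)"
    proof -
      have "u \<le> real n powr 0" unfolding u_def using n by (intro powr_mono) auto
      then show "u \<le> 1" using n by simp
    qed (use n in \<open>auto simp: u_def powr_power\<close>)
    have "cos t = cos \<bar>t\<bar>" by simp
    also have "\<dots> \<le> cos u" using t u by (intro cos_monotone_0_pi_le) (auto simp: u_def)
    finally have "1 - cos t \<ge> 1 - cos u" by simp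
    moreover have "1 - cos u \<ge> u\<^sup>2 / 2 * (1 - u\<^sup>2 / 12)" by (rule one_minus_cos_ge)
    moreover have "u\<^sup>2 / 2 * (1 - u\<^sup>2 / 12) \<ge> u\<^sup>2 / 2 * (1 / 2)"
      using u power_mono[of u 1 2] by (intro mult_left_mono) auto
    ultimately have "u\<^sup>2 / 2 * (1 / 2) \<le> 1 - cos t" by (meson order_trans)
    then have cu: "u\<^sup>2 / 8 \<le> (1 - cos t) / 2" by simp
    have nn: "n * real n powr (-1/2) = real n powr (1/2)"
    proof -
      have "n * real n powr (-1/2) = real n powr 1 * real n powr (-1/2)" using n by simp
      also have "\<dots> = real n powr (1/2)" by (subst powr_add[symmetric]) simp
      finally show ?thesis .
    qed
    have "real n powr (1/2) / 8 / 2 powr (4 * sqrt (log 2 (2 * real n)) + 12)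
        = n * (1 / 2 powr (4 * sqrt (log 2 (2 * real n)) + 12)) * (u\<^sup>2 / 8)"
      using nn by (simp add: u(3))
    also have "\<dots> \<le> n * a * ((1 - cos (t * p_seq k)) + (1 - cos (t * (p_seq k + 1))))"
      using order_trans[OF cu cos_consecutive[of t "p_seq k"]] a_ge
      by (intro mult_mono mult_left_mono) (auto simp: a_def add.commute)
    finally show ?thesis by simp
  qed
  finally show ?thesis .
qed

text \<open>Above \<open>n^(-1/4)\<close> the exponent is of order
  \<open>sqrt n / 2^(O(sqrt (log n)))\<close>, so the product is smaller than any power of
  \<open>1 / n\<close>; the number 16 comes from \<open>t^2 <= 4^2\<close>.\<close>

lemma main_prod_decay:
  "\<forall>\<^sub>F n in sequentially. \<forall>t::real. \<bar>t\<bar> \<le> pi \<longrightarrow> main_prod n t \<le> 64 / (1 + n * t\<^sup>2)"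
proof -
  have "\<forall>\<^sub>F n in sequentially. 1 \<le> lo n" using lo_at_top by (simp add: filterlim_at_top)
  moreover have "\<forall>\<^sub>F n in sequentially. real n powr (-3/4) \<le> 1 / 2" by real_asymp
  moreover have "\<forall>\<^sub>F n in sequentially. real n powr (1/4) \<le> n / 2" by real_asymp
  moreover have "\<forall>\<^sub>F n in sequentially. klog_sum n > (ln 2)\<^sup>2 / 2"
    using klog_sum_tendsto by (rule order_tendstoD) simp
  moreover have "\<forall>\<^sub>F n in sequentially.
      exp (- (real n powr (1/2) / 8 / 2 powr (4 * sqrt (log 2 (2 * real n)) + 12))) \<le> 64 / (1 + 16 * real n)"
    by real_asymp
  ultimately show ?thesis
    using lo_hi eventually_ge_at_top[of 1]
  proof eventually_elim
    case (elim n)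
    show ?case
    proof safe
      fix t :: real assume t: "\<bar>t\<bar> \<le> pi"
      show "main_prod n t \<le> 64 / (1 + n * t\<^sup>2)"
      proof (cases "real n powr (-1/4) \<le> \<bar>t\<bar>")
        case True
        have "\<bar>t\<bar>\<^sup>2 \<le> 4\<^sup>2" using t pi_less_4 by (intro power_mono) auto
        then have "n * t\<^sup>2 \<le> real n * 16" by (intro mult_left_mono) auto
        then have "64 / (1 + 16 * real n) \<le> 64 / (1 + n * t\<^sup>2)"
          by (intro divide_left_mono) (auto intro!: mult_pos_pos add_pos_nonneg)
        moreover have "main_prod n t \<le> exp (- (real n powr (1/2) / 8 / 2 powr (4 * sqrt (log 2 (2 * real n)) + 12)))"
          using elim t True by (intro main_prod_decay_large) auto
        ultimately show ?thesis using elim(5) by linarith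
      next
        case False
        have "\<bar>t\<bar>\<^sup>2 \<le> (real n powr (-1/4))\<^sup>2" using False by (intro power_mono) auto
        also have "\<dots> = real n powr (-1/2)" using elim by (simp add: powr_power)
        finally have "t\<^sup>2 * real n powr (1/2) \<le> real n powr (-1/2) * real n powr (1/2)"
          by (intro mult_right_mono) auto
        also have "\<dots> = 1" using elim by (subst powr_add[symmetric]) simp
        finally show ?thesis using elim by (intro main_prod_decay_small) auto
      qed
    qed
  qed
qed

section \<open>Characteristic functions and invariance\<close>

lemma (in prob_space) char_symmetric_trinomial:
  assumes [measurable]: "X \<in> borel_measurable M"
    and vals: "\<And>\<omega>. \<omega> \<in> space M \<Longrightarrow> X \<omega> \<in> {-1, 0, 1}"
    and "prob {\<omega> \<in> space M. X \<omega> = 1} = a / 2" "prob {\<omega> \<in> space M. X \<omega> = -1} = a / 2"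
  shows "char (distr M borel X) t = of_real (1 - a * (1 - cos t))"
proof -
  have "char (distr M borel X) t = (CLINT \<omega>|M. iexp (t * X \<omega>))"
    by (simp add: char_def integral_distr)
  also have "\<dots> = (CLINT \<omega>|M. 1 + (indicator {\<omega> \<in> space M. X \<omega> = 1} \<omega> *\<^sub>R (iexp t - 1)
     + indicator {\<omega> \<in> space M. X \<omega> = -1} \<omega> *\<^sub>R (iexp (-t) - 1)))"
    by (intro Bochner_Integration.integral_cong refl) (use vals in \<open>force simp: indicator_def\<close>)
  also have "\<dots> = 1 + ((a / 2) *\<^sub>R (iexp t - 1) + (a / 2) *\<^sub>R (iexp (-t) - 1))"
  proof -
    have A: "integrable M (\<lambda>\<omega>. indicat_real A \<omega> *\<^sub>R c)" "(CLINT \<omega>|M. indicat_real A \<omega> *\<^sub>R c) = prob A *\<^sub>R c"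
      if "A \<in> events" for A and c :: complex
    proof -
      have "integrable M (indicat_real A)" using that by (simp add: emeasure_eq_measure)
      then show "integrable M (\<lambda>\<omega>. indicat_real A \<omega> *\<^sub>R c)" by (rule integrable_scaleR_left)
      show "(CLINT \<omega>|M. indicat_real A \<omega> *\<^sub>R c) = prob A *\<^sub>R c"
        using \<open>integrable M (indicat_real A)\<close> that by (subst integral_scaleR_left) auto
    qed
    have e: "{\<omega> \<in> space M. X \<omega> = 1} \<in> events" "{\<omega> \<in> space M. X \<omega> = -1} \<in> events" by auto
    show ?thesis
      by (subst Bochner_Integration.integral_add, simp, intro Bochner_Integration.integrable_add A e,
          subst Bochner_Integration.integral_add[OF A(1)[OF e(1)] A(1)[OF e(2)]])
         (simp only: A(2)[OF e(1)] A(2)[OF e(2)] assms(3,4), simp add: prob_space)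
  qed
  also have "\<dots> = of_real (1 - a * (1 - cos t))"
    by (simp add: complex_eq_iff Re_exp Im_exp field_simps)
  finally show ?thesis .
qed

context prob_space
begin

text \<open>The character \<open>u -> exp (i * u)\<close> is 1-Lipschitz, so \<open>L1\<close>
  convergence of the partial sums carries over to characteristic functions.\<close>

lemma char_diff_le:
  assumes [measurable]: "X \<in> borel_measurable M" "Y \<in> borel_measurable M"
    and int: "integrable M (\<lambda>\<omega>. X \<omega> - Y \<omega>)"
  shows "norm (char (distr M borel X) t - char (distr M borel Y) t) \<le> \<bar>t\<bar> * expectation (\<lambda>\<omega>. \<bar>X \<omega> - Y \<omega>\<bar>)"
proof -
  have I: "integrable M (\<lambda>\<omega>. iexp (t * Z \<omega>))" if [measurable]: "Z \<in> borel_measurable M" for Z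
    by (intro integrable_const_bound[where B=1]) auto
  have "char (distr M borel X) t - char (distr M borel Y) t = (CLINT \<omega>|M. iexp (t * X \<omega>) - iexp (t * Y \<omega>))"
    using I by (simp add: char_def integral_distr)
  also have "norm \<dots> \<le> expectation (\<lambda>\<omega>. norm (iexp (t * X \<omega>) - iexp (t * Y \<omega>)))"
    by (rule integral_norm_bound)
  also have "\<dots> \<le> expectation (\<lambda>\<omega>. \<bar>t\<bar> * \<bar>X \<omega> - Y \<omega>\<bar>)"
  proof (rule integral_mono)
    fix \<omega>
    have "iexp (t * X \<omega>) - iexp (t * Y \<omega>) = iexp (t * Y \<omega>) * (iexp (t * (X \<omega> - Y \<omega>)) - 1)"
      by (simp add: exp_add[symmetric] algebra_simps)
    then have "norm (iexp (t * X \<omega>) - iexp (t * Y \<omega>)) = norm (iexp (t * (X \<omega> - Y \<omega>)) - 1)"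
      by (simp add: norm_mult del: of_real_mult)
    also have "\<dots> \<le> \<bar>t * (X \<omega> - Y \<omega>)\<bar>"
      using iexp_approx1[of "t * (X \<omega> - Y \<omega>)" 0] by simp
    finally show "norm (iexp (t * X \<omega>) - iexp (t * Y \<omega>)) \<le> \<bar>t\<bar> * \<bar>X \<omega> - Y \<omega>\<bar>"
      by (simp add: abs_mult)
  qed (use int I in auto)
  finally show ?thesis by simp
qed

text \<open>Measuring the size of a variable by the mean distance of its character from \<open>1\<close>: it is
  subadditive and controlled by the characteristic function itself, so no moments are needed.\<close>

definition char_dist :: "real \<Rightarrow> ('a \<Rightarrow> real) \<Rightarrow> real" where
  "char_dist t X = expectation (\<lambda>\<omega>. norm (iexp (t * X \<omega>) - 1))"

lemma integrable_char_dist [measurable]: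
  "X \<in> borel_measurable M \<Longrightarrow> integrable M (\<lambda>\<omega>. norm (iexp (t * X \<omega>) - 1))"
proof (intro integrable_const_bound[where B=2] AE_I2)
  fix \<omega>
  have "norm (iexp (t * X \<omega>) - 1) \<le> norm (iexp (t * X \<omega>)) + norm (1::complex)" by (rule norm_triangle_ineq4)
  then show "norm (norm (iexp (t * X \<omega>) - 1)) \<le> 2" by (simp del: of_real_mult)
qed simp

lemma char_minus_1_le:
  assumes [measurable]: "X \<in> borel_measurable M"
  shows "norm (char (distr M borel X) t - 1) \<le> char_dist t X"
proof -
  have I: "integrable M (\<lambda>\<omega>. iexp (t * X \<omega>))"
    by (intro integrable_const_bound[where B=1]) auto
  have "char (distr M borel X) t - 1 = (CLINT \<omega>|M. iexp (t * X \<omega>) - 1)"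
    using I by (simp add: char_def integral_distr prob_space)
  then show ?thesis unfolding char_dist_def by (simp only: integral_norm_bound)
qed

lemma char_dist_add:
  assumes [measurable]: "X \<in> borel_measurable M" "Y \<in> borel_measurable M"
  shows "char_dist t (\<lambda>\<omega>. X \<omega> + Y \<omega>) \<le> char_dist t X + char_dist t Y"
proof -
  have "char_dist t (\<lambda>\<omega>. X \<omega> + Y \<omega>) \<le> expectation (\<lambda>\<omega>. norm (iexp (t * X \<omega>) - 1) + norm (iexp (t * Y \<omega>) - 1))"
    unfolding char_dist_def
  proof (rule integral_mono)
    fix \<omega>
    have "iexp (t * (X \<omega> + Y \<omega>)) - 1 = iexp (t * Y \<omega>) * (iexp (t * X \<omega>) - 1) + (iexp (t * Y \<omega>) - 1)"
      by (simp add: exp_add[symmetric] algebra_simps)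
    also have "norm \<dots> \<le> norm (iexp (t * Y \<omega>) * (iexp (t * X \<omega>) - 1)) + norm (iexp (t * Y \<omega>) - 1)"
      by (rule norm_triangle_ineq)
    finally show "norm (iexp (t * (X \<omega> + Y \<omega>)) - 1) \<le> norm (iexp (t * X \<omega>) - 1) + norm (iexp (t * Y \<omega>) - 1)"
      by (simp add: norm_mult del: of_real_mult)
  qed (intro integrable_char_dist[of "\<lambda>\<omega>. X \<omega> + Y \<omega>"] integrable_char_dist[of X]
        integrable_char_dist[of Y] Bochner_Integration.integrable_add; simp)+
  also have "\<dots> = char_dist t X + char_dist t Y"
    unfolding char_dist_def by (intro Bochner_Integration.integral_add integrable_char_dist) auto
  finally show ?thesis .
qed

lemma char_dist_uminus: "char_dist t (\<lambda>\<omega>. - X \<omega>) = char_dist t X"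
proof -
  have "norm (iexp (- u) - 1) = norm (iexp u - 1)" for u
  proof -
    have "iexp (- u) - 1 = cnj (iexp u - 1)" by (simp add: exp_cnj)
    then show ?thesis by (metis complex_mod_cnj)
  qed
  from this[of "t * X _"] show ?thesis by (simp add: char_dist_def)
qed

lemma char_dist_sum:
  assumes "finite I" "\<And>i. i \<in> I \<Longrightarrow> X i \<in> borel_measurable M"
  shows "char_dist t (\<lambda>\<omega>. \<Sum>i\<in>I. X i \<omega>) \<le> (\<Sum>i\<in>I. char_dist t (X i))"
  using assms
proof (induction I rule: finite_induct)
  case (insert i I)
  have "char_dist t (\<lambda>\<omega>. X i \<omega> + (\<Sum>i\<in>I. X i \<omega>)) \<le> char_dist t (X i) + char_dist t (\<lambda>\<omega>. \<Sum>i\<in>I. X i \<omega>)"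
    using insert.prems by (intro char_dist_add) auto
  with insert show ?case by force
qed (simp add: char_dist_def)

text \<open>\<open>|exp (i * u) - 1|^2 = 2 * (1 - cos u)\<close>, and the squared mean is at most
  the mean square because a variance is nonnegative.\<close>

lemma char_dist_le:
  assumes [measurable]: "X \<in> borel_measurable M"
  shows "char_dist t X \<le> sqrt (2 * (1 - Re (char (distr M borel X) t)))"
proof -
  define g where "g \<omega> = norm (iexp (t * X \<omega>) - 1)" for \<omega>
  have [measurable]: "g \<in> borel_measurable M" unfolding g_def by measurable
  have I: "integrable M (\<lambda>\<omega>. iexp (t * X \<omega>))"
    by (intro integrable_const_bound[where B=1]) auto
  have g1: "integrable M g" unfolding g_def by (rule integrable_char_dist) simp
  have sq: "(g \<omega>)\<^sup>2 = 2 * (1 - Re (iexp (t * X \<omega>)))" for \<omega>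
    using sin_cos_squared_add[of "t * X \<omega>"]
    by (simp add: g_def cmod_power2 Re_exp Im_exp) (simp add: power2_eq_square algebra_simps)
  have IR: "integrable M (\<lambda>\<omega>. Re (iexp (t * X \<omega>)))" using integrable_Re[OF I] .
  have g2: "integrable M (\<lambda>\<omega>. (g \<omega>)\<^sup>2)"
    unfolding sq using IR by auto
  have "0 \<le> variance g" by simp
  then have "(expectation g)\<^sup>2 \<le> expectation (\<lambda>\<omega>. (g \<omega>)\<^sup>2)"
    using variance_eq[OF g1 g2] by simp
  also have "\<dots> = 2 * (1 - Re (char (distr M borel X) t))"
    unfolding sq using integral_Re[OF I] IR
    by (simp add: char_def integral_distr prob_space)
  finally show ?thesis
    unfolding char_dist_def g_def[symmetric] by (simp add: real_le_rsqrt)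
qed

end

context ergodic_invertible_pmpt
begin

lemma measurable_funpow [measurable]: "T ^^ j \<in> measurable M M"
  using measurable_T by (rule measurable_compose_n)

lemma distr_funpow: "distr M M (T ^^ j) = M"
proof (induction j)
  case (Suc j)
  have "distr M M (T ^^ Suc j) = distr (distr M M (T ^^ j)) M T"
    using measurable_T by (subst distr_distr) auto
  then show ?case using Suc preserves by (simp add: comp_def)
qed (simp add: distr_id2)

lemma distr_comp_funpow:
  assumes [measurable]: "X \<in> borel_measurable M"
  shows "distr M borel (\<lambda>\<omega>. X ((T ^^ j) \<omega>)) = distr M borel X"
proof -
  have "distr M borel (X \<circ> (T ^^ j)) = distr (distr M M (T ^^ j)) borel X"
    by (rule distr_distr[symmetric]) auto
  then show ?thesis by (simp add: distr_funpow comp_def)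
qed

lemma expectation_comp_funpow:
  fixes X :: "'a \<Rightarrow> real"
  assumes [measurable]: "X \<in> borel_measurable M"
  shows "expectation (\<lambda>\<omega>. X ((T ^^ j) \<omega>)) = expectation X"
  using integral_distr[OF measurable_funpow assms, of j] by (simp add: distr_funpow)

lemma integrable_comp_funpow:
  fixes X :: "'a \<Rightarrow> real"
  assumes "integrable M X"
  shows "integrable M (\<lambda>\<omega>. X ((T ^^ j) \<omega>))"
  using integrable_distr[OF measurable_funpow, of j X] assms by (simp add: distr_funpow)

lemma char_dist_comp_funpow:
  assumes [measurable]: "X \<in> borel_measurable M"
  shows "char_dist t (\<lambda>\<omega>. X ((T ^^ j) \<omega>)) = char_dist t X"
  unfolding char_dist_def
  using expectation_comp_funpow[of "\<lambda>\<omega>. norm (iexp (t * X \<omega>) - 1)" j] by simp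

end

section \<open>The block construction\<close>

text \<open>Splitting the sum over \<open>n + d\<close> terms after \<open>n\<close> or after
  \<open>d\<close> gives the same total. Thus a sum of length \<open>n\<close> of
  \<open>d\<close>-step differences becomes one of length \<open>d\<close> of \<open>n\<close>-step
  differences.\<close>

lemma sum_diff_shift:
  fixes H :: "nat \<Rightarrow> real"
  shows "(\<Sum>j<n. H j) - (\<Sum>j<n. H (j + d)) = (\<Sum>j<d. H j) - (\<Sum>j<d. H (j + n))"
proof -
  have "(\<Sum>j<a. H j) + (\<Sum>j<b. H (j + a)) = (\<Sum>j<a+b. H j)" for a b
    by (induction b) (simp_all add: add.commute)
  from this[of n d] this[of d n] show ?thesis by (simp add: add.commute)
qed

lemma koopman_funpow: "(koopman T ^^ i) g = (\<lambda>\<omega>. g ((T ^^ i) \<omega>))"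
  by (induction i) (auto simp: koopman_def fun_eq_iff funpow_swap1)

lemma funpow_add_apply: "(T ^^ i) ((T ^^ j) \<omega>) = (T ^^ (i + j)) \<omega>"
  by (simp add: funpow_add)

locale block_system = ergodic_invertible_pmpt M T for M :: "'a measure" and T :: "'a \<Rightarrow> 'a" +
  fixes fbar :: "nat \<Rightarrow> 'a \<Rightarrow> real"
  assumes meas: "\<And>k. k \<ge> 2 \<Longrightarrow> fbar k \<in> borel_measurable M"
    and vals: "\<And>k \<omega>. k \<ge> 2 \<Longrightarrow> \<omega> \<in> space M \<Longrightarrow> fbar k \<omega> \<in> {-1, 0, 1}"
    and iid: "\<And>k. k \<ge> 2 \<Longrightarrow>
        iid_vars M {0..2 * d_seq k + p_seq k} (\<lambda>j. fbar k \<circ> (T ^^ j))"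
    and prob_plus: "\<And>k. k \<ge> 2 \<Longrightarrow>
        measure M {\<omega> \<in> space M. fbar k \<omega> = 1} = (alpha_seq k)\<^sup>2 / 2"
    and prob_minus: "\<And>k. k \<ge> 2 \<Longrightarrow>
        measure M {\<omega> \<in> space M. fbar k \<omega> = -1} = (alpha_seq k)\<^sup>2 / 2"
    and indep: "\<And>k. k \<ge> 2 \<Longrightarrow>
        indep_families M (\<lambda>(l, j). fbar l \<circ> (T ^^ j))
          ({k} \<times> {0..2 * d_seq k + p_seq k})
          ({2..<k} \<times> {0..2 * d_seq k + p_seq k})"
begin

abbreviation \<phi> :: "('a \<Rightarrow> real) \<Rightarrow> real \<Rightarrow> complex" where
  "\<phi> X \<equiv> char (distr M borel X)"

text \<open>The Birkhoff sum of one copy in block \<open>k\<close>, regrouped by time so that each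
  of the independent variables occurs once, with its multiplicity.\<close>

definition orbit_sum :: "nat \<Rightarrow> nat \<Rightarrow> 'a \<Rightarrow> real" where
  "orbit_sum k n \<omega> = (\<Sum>m<n + p_seq k. overlap (p_seq k) n m * fbar k ((T ^^ m) \<omega>))"

lemma fbar_funpow_measurable: "k \<ge> 2 \<Longrightarrow> (\<lambda>\<omega>. fbar k ((T ^^ m) \<omega>)) \<in> borel_measurable M"
  using measurable_compose[OF measurable_funpow meas] by simp

lemma orbit_sum_measurable: "k \<ge> 2 \<Longrightarrow> orbit_sum k n \<in> borel_measurable M"
  unfolding orbit_sum_def by (intro borel_measurable_sum borel_measurable_times fbar_funpow_measurable) auto

lemma orbit_sum_eq: "orbit_sum k n \<omega> = (\<Sum>j<n. \<Sum>i<p_seq k. fbar k ((T ^^ (i + j)) \<omega>))"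
  unfolding orbit_sum_def by (rule double_sum_overlap[symmetric])

lemma f_block_eq:
  "f_block T fbar k \<omega> = (\<Sum>i<p_seq k. fbar k ((T ^^ i) \<omega>)) - (\<Sum>i<p_seq k. fbar k ((T ^^ (i + d_seq k)) \<omega>))"
  by (simp add: f_block_def Let_def koopman_funpow funpow_add_apply)

lemma birkhoff_block_double_sum:
  "birkhoff_sum T n (f_block T fbar k) \<omega> = (\<Sum>j<n. \<Sum>i<p_seq k. fbar k ((T ^^ (i + j)) \<omega>))
     - (\<Sum>j<n. \<Sum>i<p_seq k. fbar k ((T ^^ (i + (j + d_seq k))) \<omega>))"
  by (simp add: birkhoff_sum_def f_block_eq funpow_add_apply sum_subtractf add_ac)

lemma birkhoff_block:
  "birkhoff_sum T n (f_block T fbar k) \<omega> = orbit_sum k n \<omega> - orbit_sum k n ((T ^^ d_seq k) \<omega>)"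
  by (simp add: birkhoff_block_double_sum orbit_sum_eq funpow_add_apply add_ac)

text \<open>The form used when \<open>n\<close> is large against \<open>d_seq k\<close>: the
  transfer function \<open>orbit_sum k (d_seq k)\<close> does not change with
  \<open>n\<close>.\<close>

lemma birkhoff_block_coboundary:
  "birkhoff_sum T n (f_block T fbar k) \<omega> = orbit_sum k (d_seq k) \<omega> - orbit_sum k (d_seq k) ((T ^^ n) \<omega>)"
  using sum_diff_shift[of "\<lambda>j. \<Sum>i<p_seq k. fbar k ((T ^^ (i + j)) \<omega>)" n "d_seq k"]
  by (simp add: birkhoff_block_double_sum orbit_sum_eq funpow_add_apply add_ac)

lemma char_linear_combination:
  assumes k: "k \<ge> 2" and I: "I \<subseteq> {0..2 * d_seq k + p_seq k}"
  shows "\<phi> (\<lambda>\<omega>. \<Sum>m\<in>I. c m * fbar k ((T ^^ m) \<omega>)) t = of_real (\<Prod>m\<in>I. 1 - (alpha_seq k)\<^sup>2 * (1 - cos (t * c m)))"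
proof -
  have "indep_vars (\<lambda>_. borel) (\<lambda>m \<omega>. fbar k ((T ^^ m) \<omega>)) {0..2 * d_seq k + p_seq k}"
    using iid[OF k] by (simp add: iid_vars_def comp_def)
  then have "indep_vars (\<lambda>_. borel) (\<lambda>m \<omega>. c m * fbar k ((T ^^ m) \<omega>)) I"
    by (intro indep_vars_compose2[where Y="\<lambda>m x. c m * x" and M'="\<lambda>_. borel"] indep_vars_subset[OF _ I]) auto
  from char_distr_sum[OF this, of t]
  have "\<phi> (\<lambda>\<omega>. \<Sum>m\<in>I. c m * fbar k ((T ^^ m) \<omega>)) t = (\<Prod>m\<in>I. \<phi> (\<lambda>\<omega>. c m * fbar k ((T ^^ m) \<omega>)) t)"
    by simp
  also have "\<dots> = (\<Prod>m\<in>I. of_real (1 - (alpha_seq k)\<^sup>2 * (1 - cos (t * c m))))"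
  proof (rule prod.cong[OF refl])
    fix m
    have [measurable]: "fbar k \<in> borel_measurable M" using meas[OF k] .
    have "\<phi> (\<lambda>\<omega>. c m * fbar k ((T ^^ m) \<omega>)) t = \<phi> (\<lambda>\<omega>. c m * fbar k \<omega>) t"
      using distr_comp_funpow[of "\<lambda>\<omega>. c m * fbar k \<omega>" m] by simp
    also have "\<dots> = \<phi> (fbar k) (t * c m)"
      by (simp add: char_def integral_distr mult.assoc)
    also have "\<dots> = of_real (1 - (alpha_seq k)\<^sup>2 * (1 - cos (t * c m)))"
      using vals[OF k] prob_plus[OF k] prob_minus[OF k] by (intro char_symmetric_trinomial) auto
    finally show "\<phi> (\<lambda>\<omega>. c m * fbar k ((T ^^ m) \<omega>)) t = of_real (1 - (alpha_seq k)\<^sup>2 * (1 - cos (t * c m)))" .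
  qed
  finally show ?thesis by simp
qed

lemma char_orbit_sum:
  assumes k: "k \<ge> 2" and "n \<le> d_seq k"
  shows "\<phi> (orbit_sum k n) t = of_real (block_char ((alpha_seq k)\<^sup>2) (p_seq k) n t)"
proof -
  have "{..<n + p_seq k} \<subseteq> {0..2 * d_seq k + p_seq k}" using assms by auto
  from char_linear_combination[OF k this, of "\<lambda>m. real (overlap (p_seq k) n m)" t]
  show ?thesis by (simp add: orbit_sum_def[abs_def] block_char_def)
qed

lemma char_birkhoff_block:
  assumes k: "k \<ge> 2" and n: "n + p_seq k \<le> d_seq k"
  shows "\<phi> (birkhoff_sum T n (f_block T fbar k)) t = of_real (block_factor n k t)"
proof -
  define d p where "d = d_seq k" and "p = p_seq k"
  \<comment> \<open>Overlaps on the window \<open>A\<close>, their negatives on \<open>B\<close>,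
    the translate of \<open>A\<close> by \<open>d\<close>; the assumption \<open>n + p <= d\<close>
    keeps the windows disjoint. The cosine is even, so both contribute the same product.\<close>
  define c where "c m = (if m < n + p then real (overlap p n m) else - real (overlap p n (m - d)))" for m
  define A B where "A = {..<n + p}" and "B = {d..<d + (n + p)}"
  have AB: "A \<inter> B = {}" "finite A" "finite B" using n by (auto simp: A_def B_def d_def p_def)
  have shift: "sum g B = (\<Sum>m<n + p. g (m + d))" for g :: "nat \<Rightarrow> real"
    unfolding B_def by (rule sum.reindex_bij_witness[of _ "\<lambda>m. m + d" "\<lambda>m. m - d"]) auto
  have shift': "prod g B = (\<Prod>m<n + p. g (m + d))" for g :: "nat \<Rightarrow> real"
    unfolding B_def by (rule prod.reindex_bij_witness[of _ "\<lambda>m. m + d" "\<lambda>m. m - d"]) auto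
  have cd: "c (m + d) = - real (overlap p n m)" for m
    using n by (simp add: c_def d_def p_def)
  have "birkhoff_sum T n (f_block T fbar k) = (\<lambda>\<omega>. \<Sum>m\<in>A \<union> B. c m * fbar k ((T ^^ m) \<omega>))"
  proof
    fix \<omega>
    have "(\<Sum>m\<in>A \<union> B. c m * fbar k ((T ^^ m) \<omega>))
       = (\<Sum>m\<in>A. c m * fbar k ((T ^^ m) \<omega>)) + (\<Sum>m\<in>B. c m * fbar k ((T ^^ m) \<omega>))"
      using AB by (intro sum.union_disjoint) auto
    also have "(\<Sum>m\<in>A. c m * fbar k ((T ^^ m) \<omega>)) = orbit_sum k n \<omega>"
      by (simp add: orbit_sum_def A_def c_def p_def)
    also have "(\<Sum>m\<in>B. c m * fbar k ((T ^^ m) \<omega>)) = - orbit_sum k n ((T ^^ d) \<omega>)"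
      unfolding shift cd by (simp add: orbit_sum_def p_def funpow_add_apply sum_negf)
    finally show "birkhoff_sum T n (f_block T fbar k) \<omega> = (\<Sum>m\<in>A \<union> B. c m * fbar k ((T ^^ m) \<omega>))"
      by (simp add: birkhoff_block d_def)
  qed
  moreover have "A \<union> B \<subseteq> {0..2 * d_seq k + p_seq k}"
    using n by (auto simp: A_def B_def d_def p_def)
  ultimately have "\<phi> (birkhoff_sum T n (f_block T fbar k)) t
      = of_real (\<Prod>m\<in>A \<union> B. 1 - (alpha_seq k)\<^sup>2 * (1 - cos (t * c m)))"
    using char_linear_combination[OF k] by simp
  also have "(\<Prod>m\<in>A \<union> B. 1 - (alpha_seq k)\<^sup>2 * (1 - cos (t * c m)))
     = (\<Prod>m\<in>A. 1 - (alpha_seq k)\<^sup>2 * (1 - cos (t * c m))) * (\<Prod>m\<in>B. 1 - (alpha_seq k)\<^sup>2 * (1 - cos (t * c m)))"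
    using AB by (intro prod.union_disjoint) auto
  also have "\<dots> = block_factor n k t"
    unfolding shift' cd by (simp add: block_factor_def block_char_def A_def c_def p_def power2_eq_square)
  finally show ?thesis .
qed

section \<open>Partial sums and independence of the blocks\<close>

definition partial_sum :: "nat \<Rightarrow> 'a \<Rightarrow> real" where
  "partial_sum N \<omega> = (\<Sum>k = 2..N. f_block T fbar k \<omega>)"

lemma birkhoff_partial_sum:
  "birkhoff_sum T n (partial_sum N) \<omega> = (\<Sum>k = 2..N. birkhoff_sum T n (f_block T fbar k) \<omega>)"
  unfolding birkhoff_sum_def partial_sum_def comp_def by (rule sum.swap)

lemma birkhoff_block_measurable [measurable]:
  "k \<ge> 2 \<Longrightarrow> birkhoff_sum T n (f_block T fbar k) \<in> borel_measurable M"
  unfolding birkhoff_block[abs_def]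
  by (intro borel_measurable_diff orbit_sum_measurable
      measurable_compose[OF measurable_funpow orbit_sum_measurable])

lemma birkhoff_partial_sum_measurable:
  "birkhoff_sum T n (partial_sum N) \<in> borel_measurable M"
  unfolding birkhoff_partial_sum[abs_def] by (intro borel_measurable_sum birkhoff_block_measurable) auto

lemma d_seq_double: "l < k \<Longrightarrow> 2 * d_seq l \<le> d_seq k"
proof -
  assume "l < k"
  then have "l\<^sup>2 < k\<^sup>2" by (simp add: power_strict_mono)
  then have "2 ^ Suc (l\<^sup>2) \<le> (2::nat) ^ (k\<^sup>2)" by (intro power_increasing) auto
  then show ?thesis by (simp add: d_seq_def)
qed

text \<open>Both sums are measurable functions, built from \<open>Y\<close>, of the coordinates in
  the window where independence is assumed. The lower blocks also fit into it because
  \<open>2 * d_seq l <= d_seq k\<close>.\<close>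

lemma indep_birkhoff:
  assumes k: "k \<ge> 2" and n: "n + p_seq k \<le> d_seq k"
  shows "indep_var borel (birkhoff_sum T n (f_block T fbar k)) borel (birkhoff_sum T n (partial_sum (k - 1)))"
proof -
  define X where "X = (\<lambda>(l, j). fbar l \<circ> (T ^^ j))"
  define m where "m = 2 * d_seq k + p_seq k"
  define I J where "I = {k} \<times> {0..m}" and "J = {2..<k} \<times> {0..m}"
  define Y where "Y l x = (\<Sum>j<n. \<Sum>i<p_seq l. x (l, i + j)) - (\<Sum>j<n. \<Sum>i<p_seq l. x (l, i + (j + d_seq l)))"
    for l and x :: "nat \<times> nat \<Rightarrow> real"
  have range: "n + p_seq l + d_seq l \<le> m" if "2 \<le> l" "l \<le> k" for l
  proof (cases "l = k")
    case False
    then have "2 * d_seq l \<le> d_seq k" using that by (intro d_seq_double) auto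
    with d_seq_ge[OF that(1)] n show ?thesis by (simp add: m_def)
  qed (use n in \<open>simp add: m_def\<close>)
  have Y_meas: "Y l \<in> borel_measurable (PiM S (\<lambda>_. borel))" if "2 \<le> l" "l \<le> k" "{l} \<times> {0..m} \<subseteq> S" for l S
  proof -
    have "(l, i + j) \<in> S" "(l, i + (j + d_seq l)) \<in> S" if "j < n" "i < p_seq l" for i j
      using range[of l] that \<open>{l} \<times> {0..m} \<subseteq> S\<close> \<open>2 \<le> l\<close> \<open>l \<le> k\<close> by auto
    then show ?thesis
      unfolding Y_def by (intro borel_measurable_diff borel_measurable_sum measurable_component_singleton) auto
  qed
  have Y_eq: "Y l (\<lambda>i\<in>S. X i \<omega>) = birkhoff_sum T n (f_block T fbar l) \<omega>"
    if "2 \<le> l" "l \<le> k" "{l} \<times> {0..m} \<subseteq> S" for l S \<omega>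
  proof -
    have "(l, i + j) \<in> S" "(l, i + (j + d_seq l)) \<in> S" if "j < n" "i < p_seq l" for i j
      using range[of l] that \<open>{l} \<times> {0..m} \<subseteq> S\<close> \<open>2 \<le> l\<close> \<open>l \<le> k\<close> by auto
    then show ?thesis unfolding Y_def birkhoff_block_double_sum X_def by simp
  qed
  have "indep_var (PiM I (\<lambda>_. borel)) (\<lambda>\<omega>. \<lambda>i\<in>I. X i \<omega>) (PiM J (\<lambda>_. borel)) (\<lambda>\<omega>. \<lambda>j\<in>J. X j \<omega>)"
    using indep[OF k] unfolding indep_families_def X_def I_def J_def m_def by simp
  then have "indep_var borel (Y k \<circ> (\<lambda>\<omega>. \<lambda>i\<in>I. X i \<omega>))
      borel ((\<lambda>x. \<Sum>l = 2..k - 1. Y l x) \<circ> (\<lambda>\<omega>. \<lambda>j\<in>J. X j \<omega>))"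
    by (rule indep_var_compose)
       (use k in \<open>auto intro!: Y_meas borel_measurable_sum simp: I_def J_def\<close>)
  moreover have "Y k \<circ> (\<lambda>\<omega>. \<lambda>i\<in>I. X i \<omega>) = birkhoff_sum T n (f_block T fbar k)"
    using k by (auto simp: fun_eq_iff I_def intro!: Y_eq)
  moreover have "(\<lambda>x. \<Sum>l = 2..k - 1. Y l x) \<circ> (\<lambda>\<omega>. \<lambda>j\<in>J. X j \<omega>) = birkhoff_sum T n (partial_sum (k - 1))"
    using k by (auto simp: fun_eq_iff birkhoff_partial_sum J_def intro!: sum.cong Y_eq)
  ultimately show ?thesis by simp
qed

lemma char_partial_sum_Suc:
  assumes "Suc N \<ge> 2" "n + p_seq (Suc N) \<le> d_seq (Suc N)"
  shows "\<phi> (birkhoff_sum T n (partial_sum (Suc N))) t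
      = \<phi> (birkhoff_sum T n (partial_sum N)) t * of_real (block_factor n (Suc N) t)"
proof -
  have "birkhoff_sum T n (partial_sum (Suc N))
      = (\<lambda>\<omega>. birkhoff_sum T n (f_block T fbar (Suc N)) \<omega> + birkhoff_sum T n (partial_sum (Suc N - 1)) \<omega>)"
    using assms(1) by (simp add: fun_eq_iff birkhoff_partial_sum)
  then show ?thesis
    using char_distr_add[OF indep_birkhoff[OF assms], of t] char_birkhoff_block[OF assms, of t] by simp
qed

text \<open>Blocks above \<open>lo n\<close> are split off from the top, each independent of
  everything below; the low part stays as an unevaluated factor.\<close>

lemma char_partial_sum:
  assumes "n \<ge> 1" "lo n \<ge> 1" "lo n \<le> N"
  shows "\<phi> (birkhoff_sum T n (partial_sum N)) t
      = \<phi> (birkhoff_sum T n (partial_sum (lo n))) t * of_real (\<Prod>k\<in>{lo n<..N}. block_factor n k t)"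
  using assms(3)
proof (induction N rule: dec_induct)
  case (step N)
  have "2 * n \<le> d_seq (Suc N)" using assms step by (intro d_seq_ge_lo) auto
  moreover have "2 * p_seq (Suc N) \<le> d_seq (Suc N)" using assms step by (intro d_seq_ge) auto
  ultimately have "n + p_seq (Suc N) \<le> d_seq (Suc N)" by simp
  moreover have "{lo n<..Suc N} = insert (Suc N) {lo n<..N}" using step by auto
  ultimately show ?case using assms step by (simp add: char_partial_sum_Suc mult_ac)
qed simp

text \<open>A sum of length \<open>d_seq k\<close> still fits into the i.i.d. window, so its
  characteristic function is explicit and \<open>char_dist_le\<close> applies.\<close>

lemma char_dist_orbit_sum_le:
  assumes k: "k \<ge> 2"
  shows "char_dist t (orbit_sum k (d_seq k)) \<le> \<bar>t\<bar> * sqrt (recip_klog k * d_seq k)"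
proof -
  have "char_dist t (orbit_sum k (d_seq k)) \<le> sqrt (2 * (1 - block_char ((alpha_seq k)\<^sup>2) (p_seq k) (d_seq k) t))"
    using char_dist_le[OF orbit_sum_measurable[OF k, of "d_seq k"], of t] by (simp add: char_orbit_sum[OF k])
  also have "\<dots> \<le> sqrt (t\<^sup>2 * (recip_klog k * d_seq k))"
  proof (rule real_sqrt_le_mono)
    have "1 - block_char ((alpha_seq k)\<^sup>2) (p_seq k) (d_seq k) t
       \<le> (alpha_seq k)\<^sup>2 * t\<^sup>2 / 2 * min (p_seq k) (d_seq k) * d_seq k * p_seq k"
      by (rule one_minus_block_char_le[OF alpha_sq_bounds[OF k]])
    also have "min (p_seq k) (d_seq k) = p_seq k" using d_seq_ge[OF k] by simp
    also have "(alpha_seq k)\<^sup>2 * t\<^sup>2 / 2 * p_seq k * d_seq k * p_seq k = t\<^sup>2 * (recip_klog k * d_seq k) / 2"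
      by (simp add: alpha_sq_p_sq[OF k, symmetric] power2_eq_square)
    finally show "2 * (1 - block_char ((alpha_seq k)\<^sup>2) (p_seq k) (d_seq k) t) \<le> t\<^sup>2 * (recip_klog k * d_seq k)"
      by simp
  qed
  finally show ?thesis by (simp add: real_sqrt_mult)
qed

text \<open>The low blocks, and the two ends of each coboundary, may be dependent, so subadditivity
  of \<open>char_dist\<close> replaces the product formula; by invariance both ends have the same
  size.\<close>

lemma char_small_blocks:
  assumes "n \<ge> 1"
  shows "norm (\<phi> (birkhoff_sum T n (partial_sum (lo n))) t - 1) \<le> 2 * \<bar>t\<bar> * sqrt n * coboundary_bound n"
proof -
  have "norm (\<phi> (birkhoff_sum T n (partial_sum (lo n))) t - 1) \<le> char_dist t (birkhoff_sum T n (partial_sum (lo n)))"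
    by (intro char_minus_1_le birkhoff_partial_sum_measurable)
  also have "\<dots> \<le> (\<Sum>k = 2..lo n. char_dist t (birkhoff_sum T n (f_block T fbar k)))"
    unfolding birkhoff_partial_sum[abs_def] by (intro char_dist_sum) auto
  also have "\<dots> \<le> (\<Sum>k = 2..lo n. 2 * \<bar>t\<bar> * sqrt n * sqrt (recip_klog k * d_seq k / n))"
  proof (rule sum_mono)
    fix k assume "k \<in> {2..lo n}"
    then have k: "k \<ge> 2" by simp
    define W where "W = orbit_sum k (d_seq k)"
    have [measurable]: "W \<in> borel_measurable M" unfolding W_def by (rule orbit_sum_measurable[OF k])
    have "char_dist t (birkhoff_sum T n (f_block T fbar k)) = char_dist t (\<lambda>\<omega>. W \<omega> + - W ((T ^^ n) \<omega>))"
      unfolding birkhoff_block_coboundary[abs_def] W_def by simp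
    also have "\<dots> \<le> char_dist t W + char_dist t (\<lambda>\<omega>. - W ((T ^^ n) \<omega>))"
      by (rule char_dist_add) measurable
    also have "char_dist t (\<lambda>\<omega>. - W ((T ^^ n) \<omega>)) = char_dist t W"
      by (simp add: char_dist_uminus char_dist_comp_funpow)
    also have "char_dist t W \<le> \<bar>t\<bar> * sqrt (recip_klog k * d_seq k)"
      unfolding W_def by (rule char_dist_orbit_sum_le[OF k])
    finally show "char_dist t (birkhoff_sum T n (f_block T fbar k)) \<le> 2 * \<bar>t\<bar> * sqrt n * sqrt (recip_klog k * d_seq k / n)"
      using assms by (simp add: real_sqrt_divide)
  qed
  also have "\<dots> = 2 * \<bar>t\<bar> * sqrt n * coboundary_bound n"
    by (simp add: coboundary_bound_def sum_distrib_left)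
  finally show ?thesis .
qed

lemma partial_sum_Ints:
  assumes "\<omega> \<in> space M"
  shows "birkhoff_sum T n (partial_sum N) \<omega> \<in> \<int>"
proof -
  have "fbar k ((T ^^ j) \<omega>) \<in> \<int>" if "k \<ge> 2" for k j
  proof -
    have "(T ^^ j) \<omega> \<in> space M" using measurable_space[OF measurable_funpow assms] .
    then show ?thesis using vals[OF that] by fastforce
  qed
  then show ?thesis
    unfolding birkhoff_partial_sum birkhoff_block_double_sum by (intro Ints_sum Ints_diff) auto
qed

end

section \<open>From partial sums to the infinite series\<close>

context block_system
begin

text \<open>By invariance the error is at most \<open>n\<close> times the \<open>L2\<close> error of
  the series; \<open>n\<close> is fixed while \<open>N\<close> grows, so this factor is
  harmless.\<close>

lemma birkhoff_L1_tendsto: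
  assumes f: "L2_tendsto M partial_sum f"
  shows "birkhoff_sum T n f \<in> borel_measurable M"
    and "integrable M (\<lambda>\<omega>. birkhoff_sum T n (partial_sum N) \<omega> - birkhoff_sum T n f \<omega>)"
    and "(\<lambda>N. expectation (\<lambda>\<omega>. \<bar>birkhoff_sum T n (partial_sum N) \<omega> - birkhoff_sum T n f \<omega>\<bar>)) \<longlonglongrightarrow> 0"
proof -
  have f_meas [measurable]: "f \<in> borel_measurable M" and F_meas [measurable]: "partial_sum N \<in> borel_measurable M" for N
    using f by (auto simp: L2_tendsto_def L2_fun_def)
  define e where "e N \<omega> = partial_sum N \<omega> - f \<omega>" for N \<omega>
  have [measurable]: "e N \<in> borel_measurable M" for N unfolding e_def by measurable
  have int: "integrable M (partial_sum N)" "integrable M f" for N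
    using f by (auto simp: L2_tendsto_def L2_fun_def intro: square_integrable_imp_integrable)
  have e1: "integrable M (e N)" for N
    unfolding e_def by (intro Bochner_Integration.integrable_diff int)
  have e2: "integrable M (\<lambda>\<omega>. (e N \<omega>)\<^sup>2)" for N
  proof (rule Bochner_Integration.integrable_bound)
    show "integrable M (\<lambda>\<omega>. 2 * (partial_sum N \<omega>)\<^sup>2 + 2 * (f \<omega>)\<^sup>2)"
      using f by (auto simp: L2_tendsto_def L2_fun_def)
    have "(x - y)\<^sup>2 \<le> 2 * x\<^sup>2 + 2 * y\<^sup>2" for x y :: real
      using zero_le_power2[of "x + y"] by (simp add: power2_eq_square algebra_simps)
    then show "AE \<omega> in M. norm ((e N \<omega>)\<^sup>2) \<le> norm (2 * (partial_sum N \<omega>)\<^sup>2 + 2 * (f \<omega>)\<^sup>2)"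
      by (simp add: e_def)
  qed measurable
  have diff: "birkhoff_sum T n (partial_sum N) \<omega> - birkhoff_sum T n f \<omega> = (\<Sum>j<n. e N ((T ^^ j) \<omega>))" for N \<omega>
    by (simp add: birkhoff_sum_def e_def sum_subtractf)
  show "birkhoff_sum T n f \<in> borel_measurable M"
    unfolding birkhoff_sum_def[abs_def] by measurable
  show "integrable M (\<lambda>\<omega>. birkhoff_sum T n (partial_sum N) \<omega> - birkhoff_sum T n f \<omega>)"
    unfolding diff by (intro Bochner_Integration.integrable_sum integrable_comp_funpow e1)
  have bound: "expectation (\<lambda>\<omega>. \<bar>\<Sum>j<n. e N ((T ^^ j) \<omega>)\<bar>) \<le> n * sqrt (expectation (\<lambda>\<omega>. (e N \<omega>)\<^sup>2))" for N
  proof -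
    have abs_int: "integrable M (\<lambda>\<omega>. \<bar>e N \<omega>\<bar>)" using e1 by simp
    have "expectation (\<lambda>\<omega>. \<bar>\<Sum>j<n. e N ((T ^^ j) \<omega>)\<bar>) \<le> expectation (\<lambda>\<omega>. \<Sum>j<n. \<bar>e N ((T ^^ j) \<omega>)\<bar>)"
      by (intro integral_mono integrable_abs Bochner_Integration.integrable_sum integrable_comp_funpow e1
          integrable_comp_funpow[OF abs_int] sum_abs)
    also have "\<dots> = (\<Sum>j<n. expectation (\<lambda>\<omega>. \<bar>e N ((T ^^ j) \<omega>)\<bar>))"
      by (intro Bochner_Integration.integral_sum integrable_comp_funpow[OF abs_int])
    also have "\<dots> = n * expectation (\<lambda>\<omega>. \<bar>e N \<omega>\<bar>)"
      using expectation_comp_funpow[of "\<lambda>\<omega>. \<bar>e N \<omega>\<bar>"] by simp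
    also have "expectation (\<lambda>\<omega>. \<bar>e N \<omega>\<bar>) \<le> sqrt (expectation (\<lambda>\<omega>. (e N \<omega>)\<^sup>2))"
    proof (rule real_le_rsqrt)
      have "0 \<le> variance (\<lambda>\<omega>. \<bar>e N \<omega>\<bar>)" by simp
      then show "(expectation (\<lambda>\<omega>. \<bar>e N \<omega>\<bar>))\<^sup>2 \<le> expectation (\<lambda>\<omega>. (e N \<omega>)\<^sup>2)"
        using variance_eq[OF abs_int] e2 by simp
    qed
    finally show ?thesis by (simp add: mult_left_mono)
  qed
  have "(\<lambda>N. expectation (\<lambda>\<omega>. (e N \<omega>)\<^sup>2)) \<longlonglongrightarrow> 0"
    using f by (simp add: L2_tendsto_def e_def)
  from tendsto_mult_right_zero[OF tendsto_real_sqrt[OF this, unfolded real_sqrt_zero], of "real n"]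
  show "(\<lambda>N. expectation (\<lambda>\<omega>. \<bar>birkhoff_sum T n (partial_sum N) \<omega> - birkhoff_sum T n f \<omega>\<bar>)) \<longlonglongrightarrow> 0"
    unfolding diff
    by (rule tendsto_sandwich[OF _ _ tendsto_const, rotated 2]) (auto intro!: always_eventually bound)
qed

lemma char_partial_sum_tendsto:
  assumes f: "L2_tendsto M partial_sum f"
  shows "(\<lambda>N. \<phi> (birkhoff_sum T n (partial_sum N)) t) \<longlonglongrightarrow> \<phi> (birkhoff_sum T n f) t"
proof (rule LIM_zero_cancel, rule Lim_null_comparison)
  show "\<forall>\<^sub>F N in sequentially. norm (\<phi> (birkhoff_sum T n (partial_sum N)) t - \<phi> (birkhoff_sum T n f) t)
     \<le> \<bar>t\<bar> * expectation (\<lambda>\<omega>. \<bar>birkhoff_sum T n (partial_sum N) \<omega> - birkhoff_sum T n f \<omega>\<bar>)"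
    using birkhoff_L1_tendsto[OF f] birkhoff_partial_sum_measurable
    by (intro always_eventually allI char_diff_le) auto
  show "(\<lambda>N. \<bar>t\<bar> * expectation (\<lambda>\<omega>. \<bar>birkhoff_sum T n (partial_sum N) \<omega> - birkhoff_sum T n f \<omega>\<bar>)) \<longlonglongrightarrow> 0"
    by (intro tendsto_mult_right_zero birkhoff_L1_tendsto f)
qed

text \<open>The distance to the nearest integer is at most the distance to the integer-valued
  partial sums, so its mean is 0. An \<open>L2\<close> limit is fixed only almost everywhere, hence
  the form of the conclusion.\<close>

lemma birkhoff_AE_Ints:
  assumes f: "L2_tendsto M partial_sum f"
  shows "AE \<omega> in M. birkhoff_sum T n f \<omega> \<in> \<int>"
proof -
  define S where "S = birkhoff_sum T n f"
  define g where "g \<omega> = \<bar>S \<omega> - of_int (round (S \<omega>))\<bar>" for \<omega>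
  have [measurable]: "S \<in> borel_measurable M" unfolding S_def by (rule birkhoff_L1_tendsto[OF f])
  have [measurable]: "g \<in> borel_measurable M" unfolding g_def round_def by measurable
  have g_le: "g \<omega> \<le> \<bar>birkhoff_sum T n (partial_sum N) \<omega> - S \<omega>\<bar>" if "\<omega> \<in> space M" for N \<omega>
  proof -
    from partial_sum_Ints[OF that, of n N] obtain m where m: "birkhoff_sum T n (partial_sum N) \<omega> = of_int m"
      by (auto elim: Ints_cases)
    show ?thesis
      unfolding g_def m using round_diff_minimal[of "S \<omega>" m] by (simp add: abs_minus_commute)
  qed
  have g_int: "integrable M g"
  proof (rule integrable_const_bound[where B=1])
    have "norm (g \<omega>) \<le> 1" for \<omega>
      using of_int_round_abs_le[of "S \<omega>"] by (simp add: g_def abs_minus_commute)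
    then show "AE \<omega> in M. norm (g \<omega>) \<le> 1" by simp
  qed simp
  have "expectation g \<le> expectation (\<lambda>\<omega>. \<bar>birkhoff_sum T n (partial_sum N) \<omega> - S \<omega>\<bar>)" for N
    using birkhoff_L1_tendsto(2)[OF f, of n N] unfolding S_def[symmetric]
    by (intro integral_mono g_int integrable_abs g_le)
  then have "expectation g \<le> 0"
    using birkhoff_L1_tendsto(3)[OF f, of n] unfolding S_def[symmetric]
    by (intro LIMSEQ_le_const) auto
  moreover have "expectation g \<ge> 0" by (simp add: g_def)
  ultimately have "expectation g = 0" by simp
  then have "AE \<omega> in M. g \<omega> = 0"
    using integral_nonneg_eq_0_iff_AE[OF g_int] by (simp add: g_def)
  then show ?thesis
  proof eventually_elim
    case (elim \<omega>)
    then have "S \<omega> = of_int (round (S \<omega>))" by (simp add: g_def)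
    then show ?case unfolding S_def by (metis Ints_of_int)
  qed
qed

text \<open>The low part has modulus at most 1 and the product of the high blocks lies in
  \<open>[0, 1]\<close>. The bound thus holds for every partial sum with \<open>N >= hi n\<close>
  and survives the limit.\<close>

lemma char_birkhoff_le:
  assumes f: "L2_tendsto M partial_sum f" and n: "n \<ge> 1" "1 \<le> lo n" "lo n \<le> hi n"
  shows "norm (\<phi> (birkhoff_sum T n f) t) \<le> main_prod n t"
proof (rule LIMSEQ_le_const2[OF tendsto_norm[OF char_partial_sum_tendsto[OF f]]])
  show "\<exists>N0. \<forall>N\<ge>N0. norm (\<phi> (birkhoff_sum T n (partial_sum N)) t) \<le> main_prod n t"
  proof (intro exI allI impI)
    fix N assume N: "hi n \<le> N"
    interpret D: real_distribution "distr M borel (birkhoff_sum T n (partial_sum (lo n)))"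
      by (intro real_distribution_distr birkhoff_partial_sum_measurable)
    have sub: "{lo n<..N} \<subseteq> {2..}" "{lo n<..hi n} \<subseteq> {2..}" "{hi n<..N} \<subseteq> {2..}" using n by auto
    have "{lo n<..N} = {lo n<..hi n} \<union> {hi n<..N}" using n N by auto
    then have "(\<Prod>k\<in>{lo n<..N}. block_factor n k t) = main_prod n t * (\<Prod>k\<in>{hi n<..N}. block_factor n k t)"
      unfolding main_prod_def by (subst prod.union_disjoint[symmetric]) auto
    also have "\<dots> \<le> main_prod n t * 1"
      unfolding main_prod_def by (intro mult_left_mono prod_block_factor_bounds sub)
    finally have "norm (\<phi> (birkhoff_sum T n (partial_sum (lo n))) t) * (\<Prod>k\<in>{lo n<..N}. block_factor n k t) \<le> 1 * main_prod n t"
      by (intro mult_mono D.cmod_char_le_1 prod_block_factor_bounds(1)[OF sub(1)]) auto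
    then show "norm (\<phi> (birkhoff_sum T n (partial_sum N)) t) \<le> main_prod n t"
      using n N prod_block_factor_bounds(1)[OF sub(1), of n t]
      by (subst char_partial_sum) (auto simp: norm_mult simp del: of_real_prod)
  qed
qed

text \<open>With \<open>c\<close>, \<open>m\<close>, \<open>r\<close> for the low, main and high
  parts, \<open>c * m * r - m = m * r * (c - 1) - m * (1 - r)\<close>. The bound is meant for
  \<open>t = s / sqrt n\<close>, where \<open>n * t^2 = s^2\<close>.\<close>

lemma char_birkhoff_approx:
  assumes f: "L2_tendsto M partial_sum f" and n: "n \<ge> 1" "1 \<le> lo n" "lo n \<le> hi n" "2 \<le> hi n"
  shows "norm (\<phi> (birkhoff_sum T n f) t - main_prod n t)
     \<le> 2 * \<bar>t\<bar> * sqrt n * coboundary_bound n + (n * t\<^sup>2) * (recip_klog (hi n) * (3 * real (hi n) + 6))"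
    (is "_ \<le> ?B")
proof (rule LIMSEQ_le_const2[OF tendsto_norm[OF tendsto_diff[OF char_partial_sum_tendsto[OF f] tendsto_const]]])
  show "\<exists>N0. \<forall>N\<ge>N0. norm (\<phi> (birkhoff_sum T n (partial_sum N)) t - main_prod n t) \<le> ?B"
  proof (intro exI allI impI)
    fix N assume N: "hi n \<le> N"
    define c where "c = \<phi> (birkhoff_sum T n (partial_sum (lo n))) t"
    define m where "m = main_prod n t"
    define r where "r = (\<Prod>k\<in>{hi n<..N}. block_factor n k t)"
    have sub: "{lo n<..hi n} \<subseteq> {2..}" "{hi n<..N} \<subseteq> {2..}" using n by auto
    have m: "0 \<le> m" "m \<le> 1" unfolding m_def main_prod_def by (rule prod_block_factor_bounds[OF sub(1)])+
    have r: "0 \<le> r" "r \<le> 1" unfolding r_def by (rule prod_block_factor_bounds[OF sub(2)])+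
    have "{lo n<..N} = {lo n<..hi n} \<union> {hi n<..N}" using n N by auto
    then have e: "(\<Prod>k\<in>{lo n<..N}. block_factor n k t) = m * r"
      unfolding m_def main_prod_def r_def by (subst prod.union_disjoint[symmetric]) auto
    have "\<phi> (birkhoff_sum T n (partial_sum N)) t - m = c * of_real (m * r) - m"
      unfolding c_def e[symmetric] using n N by (subst char_partial_sum) auto
    also have "\<dots> = of_real (m * r) * (c - 1) - of_real (m * (1 - r))"
      by (simp add: algebra_simps)
    also have "norm \<dots> \<le> norm (of_real (m * r) * (c - 1)) + norm (complex_of_real (m * (1 - r)))"
      by (rule norm_triangle_ineq4)
    also have "\<dots> = (m * r) * norm (c - 1) + m * (1 - r)"
      using m r by (simp only: norm_mult norm_of_real) simp
    also have "\<dots> \<le> 1 * norm (c - 1) + 1 * (1 - r)"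
      using m r by (intro add_mono mult_right_mono mult_le_one) auto
    also have "\<dots> \<le> ?B"
      using char_small_blocks[OF n(1), of t] tail_prod_bound[OF n(4) n(1), of t N]
      by (simp add: c_def r_def)
    finally show "norm (\<phi> (birkhoff_sum T n (partial_sum N)) t - main_prod n t) \<le> ?B"
      by (simp add: m_def)
  qed
qed

theorem birkhoff_local_limit:
  assumes f: "L2_tendsto M partial_sum f"
  shows "(\<lambda>n. SUP x::int.
           \<bar>sqrt (real n) * prob {\<omega> \<in> space M. birkhoff_sum T n f \<omega> = of_int x}
             - exp (- ((of_int x)\<^sup>2 / (2 * real n * sigma_sq))) / sqrt (2 * pi * sigma_sq)\<bar>)
         \<longlonglongrightarrow> 0"
proof (rule local_limit_criterion[where D=64])
  show "birkhoff_sum T n f \<in> borel_measurable M" for n by (rule birkhoff_L1_tendsto[OF f])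
  show "AE \<omega> in M. birkhoff_sum T n f \<omega> \<in> \<int>" for n by (rule birkhoff_AE_Ints[OF f])
  show "sigma_sq > 0" by (simp add: sigma_sq_def)
  have "\<forall>\<^sub>F n in sequentially. 2 \<le> lo n" using lo_at_top by (simp add: filterlim_at_top)
  with lo_hi eventually_ge_at_top[of 1]
  have ev: "\<forall>\<^sub>F n in sequentially. n \<ge> 1 \<and> 1 \<le> lo n \<and> lo n \<le> hi n \<and> 2 \<le> hi n"
    by eventually_elim auto
  show "\<forall>\<^sub>F n in sequentially. \<forall>t::real. \<bar>t\<bar> \<le> pi \<longrightarrow>
        norm (\<phi> (birkhoff_sum T n f) t) \<le> 64 / (1 + real n * t\<^sup>2)"
    using ev main_prod_decay
  proof eventually_elim
    case (elim n)
    then show ?case using char_birkhoff_le[OF f, of n] by (meson order_trans)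
  qed
  show "(\<lambda>n. \<phi> (birkhoff_sum T n f) (s / sqrt n)) \<longlonglongrightarrow> exp (- (sigma_sq * s\<^sup>2 / 2))" for s
  proof -
    have "(\<lambda>n. \<phi> (birkhoff_sum T n f) (s / sqrt n) - of_real (main_prod n (s / sqrt n))) \<longlonglongrightarrow> 0"
    proof (rule Lim_null_comparison)
      show "\<forall>\<^sub>F n in sequentially. norm (\<phi> (birkhoff_sum T n f) (s / sqrt n) - of_real (main_prod n (s / sqrt n)))
         \<le> 2 * \<bar>s\<bar> * coboundary_bound n + s\<^sup>2 * (recip_klog (hi n) * (3 * real (hi n) + 6))"
        using ev
      proof eventually_elim
        case (elim n)
        then show ?case using char_birkhoff_approx[OF f, of n "s / sqrt n"] by (simp add: power_divide)
      qed
      have "(\<lambda>n. 2 * \<bar>s\<bar> * coboundary_bound n + s\<^sup>2 * (recip_klog (hi n) * (3 * real (hi n) + 6))) \<longlonglongrightarrow> 2 * \<bar>s\<bar> * 0 + s\<^sup>2 * 0"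
        by (intro tendsto_intros coboundary_bound_tendsto tail_bound_tendsto)
      then show "(\<lambda>n. 2 * \<bar>s\<bar> * coboundary_bound n + s\<^sup>2 * (recip_klog (hi n) * (3 * real (hi n) + 6))) \<longlonglongrightarrow> 0" by simp
    qed
    from tendsto_add[OF this tendsto_of_real[OF main_prod_tendsto[of s]]] show ?thesis by simp
  qed
qed

end

theorem theorem4:
  fixes M :: "'a measure" and T :: "'a \<Rightarrow> 'a"
    and fbar :: "nat \<Rightarrow> 'a \<Rightarrow> real" and f :: "'a \<Rightarrow> real"
  assumes sys: "ergodic_invertible_pmpt M T"
    and meas: "\<And>k. k \<ge> 2 \<Longrightarrow> fbar k \<in> borel_measurable M"
    and vals: "\<And>k \<omega>. k \<ge> 2 \<Longrightarrow> \<omega> \<in> space M \<Longrightarrow> fbar k \<omega> \<in> {-1, 0, 1}"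
    and iid: "\<And>k. k \<ge> 2 \<Longrightarrow>
        iid_vars M {0..2 * d_seq k + p_seq k} (\<lambda>j. fbar k \<circ> (T ^^ j))"
    and prob_plus: "\<And>k. k \<ge> 2 \<Longrightarrow>
        measure M {\<omega> \<in> space M. fbar k \<omega> = 1} = (alpha_seq k)\<^sup>2 / 2"
    and prob_minus: "\<And>k. k \<ge> 2 \<Longrightarrow>
        measure M {\<omega> \<in> space M. fbar k \<omega> = -1} = (alpha_seq k)\<^sup>2 / 2"
    and indep: "\<And>k. k \<ge> 2 \<Longrightarrow>
        indep_families M (\<lambda>(l, j). fbar l \<circ> (T ^^ j))
          ({k} \<times> {0..2 * d_seq k + p_seq k})
          ({2..<k} \<times> {0..2 * d_seq k + p_seq k})"
    and f_sum: "L2_tendsto M (\<lambda>N \<omega>. \<Sum>k = 2..N. f_block T fbar k \<omega>) f"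
  shows "(\<lambda>n. SUP x::int.
           \<bar>sqrt (real n) * measure M {\<omega> \<in> space M. birkhoff_sum T n f \<omega> = of_int x}
             - exp (- ((of_int x)\<^sup>2 / (2 * real n * sigma_sq))) / sqrt (2 * pi * sigma_sq)\<bar>)
         \<longlonglongrightarrow> 0"
proof -
  interpret S: block_system M T fbar
    by (rule block_system.intro[OF sys], rule block_system_axioms.intro)
       (fact meas vals iid prob_plus prob_minus indep)+
  from f_sum have "L2_tendsto M S.partial_sum f"
    by (simp add: S.partial_sum_def[abs_def])
  then show ?thesis by (rule S.birkhoff_local_limit)
qed

end
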